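(* Let $\mathrm{Ca}>0$, $\mathrm{We}>0$, $\gamma>1$, and for $l\ge0$ consider the deformation resonance equation $\lambda^2+\hat r_lG_l(\epsilon\lambda)=0$ with $\epsilon>0$. (i) For $l=0$, the two deformation resonances are $$\lambda_0^\pm(\epsilon)=\pm\sqrt{r_0-\frac{r_0^2}{4}\epsilon^2}-i\frac{r_0}{2}\epsilon,\qquad r_0=\frac{3\gamma}{2}\mathrm{Ca}+2(3\gamma-1)\frac{1}{\mathrm{We}}.$$ (ii) Fix $L^*>2$. There exists $\epsilon^*(L^* )$ such that for $\epsilon\le\epsilon^*$ and $2\le l\le L^*$, two of the $l+2$ deformation resonances are $\lambda_l^\pm(\epsilon)=\operatorname{Re}\lambda_l^\pm(\epsilon)+i\operatorname{Im}\lambda_l^\pm(\epsilon)$ with $$\operatorname{Re}\lambda_l^\pm(\epsilon)=\pm\sqrt{\tfrac{1}{\mathrm{We}}(l+2)(l-1)(l+1)}\left[1-\frac{(l+2)(l-1)}{2(2l-1)}\left(\frac{\epsilon}{\sqrt{\mathrm{We}}}\right)^2+\mathcal{O}_{l,\mathrm{real}}(\epsilon^4)\right],$$ $$\operatorname{Im}\lambda_l^\pm(\epsilon)=-\frac{1}{\epsilon}\left[\frac12\big[(l+2)(l-1)\big]^{l+1}(l+1)^l\left[\frac{2^ll!}{(2l)!}\right]^2\left(\frac{\epsilon}{\sqrt{\mathrm{We}}}\right)^{2l+2}+\mathcal{O}_l\Big(\big[\epsilon\,\mathrm{We}^{-1/2}\big]^{2l+4}\Big)\right].$$ (iii) In the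 limit $\epsilon\to0^+$, the equation reduces to $$\lambda^2+\hat r_lG_l(0)=\lambda^2-3\gamma\left(\tfrac{\mathrm{Ca}}{2}+\tfrac{2}{\mathrm{We}}\right)\delta_{l0}-\tfrac{1}{\mathrm{We}}(l+2)(l+1)(l-1)=0,\qquad l=0,2,3,\dots,$$ which has the two real roots $\lambda_l^\pm(0)=\pm\sqrt{3\gamma\left(\frac{\mathrm{Ca}}{2}+\frac{2}{\mathrm{We}}\right)\delta_{l0}+\frac{1}{\mathrm{We}}(l+2)(l+1)(l-1)}$, and the corresponding functions $\Psi_l^\pm=A_l^\pm e^{-i\lambda_l^\pm(0)t}Y_l^m(\Omega)r^{-l-1}$, $\beta_l^\pm=B_l^\pm e^{-i\lambda_l^\pm(0)t}Y_l^m(\Omega)$ are undamped oscillatory solutions of the linearized (incompressible, $\epsilon=0$) perturbation equations.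
   Context: $h_l^{(1)}$ is the outgoing spherical Hankel function of order $l$, $G_l(z)=z\,\partial h_l^{(1)}(z)/h_l^{(1)}(z)$ (so $G_l(0):=\lim_{z\to0}G_l(z)=-(l+1)$). $\hat r_0=\frac{3\gamma}{2}\mathrm{Ca}+2(3\gamma-1)\frac{1}{\mathrm{We}}$ and $\hat r_l=\frac{1}{\mathrm{We}}(l+2)(l-1)$ for $l\ge1$. For $l=0,2,3,\dots$ and $\epsilon>0$ the equation $\lambda^2+\hat r_lG_l(\epsilon\lambda)=0$ has $l+2$ solutions (deformation resonances). $Y_l^m$ are spherical harmonics. The linearized perturbation equations at $\epsilon=0$ are: $\Delta\Psi=0$ for $r>1$, $\partial_r\Psi=\partial_t\beta$ and $\partial_t\Psi=3\gamma(\frac{\mathrm{Ca}}{2}+\frac{2}{\mathrm{We}})\langle\beta,Y_0^0\rangle Y_0^0-\frac{1}{\mathrm{We}}(2+\Delta_S)\beta$ at $r=1$, with $\Delta_S$ the Laplacian on $S^2$. $\delta_{l0}$ is the Kronecker delta; $\mathcal{O}_{l,\mathrm{real}}(\epsilon^4)$ denotes a real-valued error bounded by an $l$-dependent constant times $\epsilon^4$. *)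

theory Defs
  imports "HOL-Analysis.Analysis" "HOL-Computational_Algebra.Polynomial"
begin

text \<open>Outgoing spherical Hankel function of integer order l (closed finite form):
  h_l^(1)(z) = (-i)^(l+1) e^(iz)/z * sum_{k=0}^l i^k (l+k)! / (k! (l-k)! (2z)^k).\<close>
definition hankel1 :: "nat \<Rightarrow> complex \<Rightarrow> complex" where
  "hankel1 l z = (-\<i>) ^ (l + 1) * exp (\<i> * z) / z *
     (\<Sum>k\<le>l. \<i> ^ k * of_nat (fact (l + k)) /
        (of_nat (fact k) * of_nat (fact (l - k)) * (2 * z) ^ k))"

text \<open>G_l(z) = z h_l'(z) / h_l(z), with the convention G_l(0) = -(l+1) (its limit at 0).\<close>
definition Gfun :: "nat \<Rightarrow> complex \<Rightarrow> complex" where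
  "Gfun l z = (if z = 0 then - of_nat (l + 1) else z * deriv (hankel1 l) z / hankel1 l z)"

definition rhat :: "real \<Rightarrow> real \<Rightarrow> real \<Rightarrow> nat \<Rightarrow> real" where
  "rhat Ca We \<gamma> l = (if l = 0 then 3 * \<gamma> / 2 * Ca + 2 * (3 * \<gamma> - 1) * (1 / We)
                       else (1 / We) * (real l + 2) * (real l - 1))"

text \<open>A deformation resonance: a solution lambda of lambda^2 + hat r_l G_l(eps lambda) = 0
  (at points where h_l vanishes, G_l has a pole, so these are excluded).\<close>
definition deformation_resonance :: "real \<Rightarrow> real \<Rightarrow> real \<Rightarrow> nat \<Rightarrow> real \<Rightarrow> complex \<Rightarrow> bool" where
  "deformation_resonance Ca We \<gamma> l \<epsilon> lam \<longleftrightarrow>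
     (complex_of_real \<epsilon> * lam = 0 \<or> hankel1 l (complex_of_real \<epsilon> * lam) \<noteq> 0) \<and>
     lam ^ 2 + complex_of_real (rhat Ca We \<gamma> l) * Gfun l (complex_of_real \<epsilon> * lam) = 0"

definition legendre_poly :: "nat \<Rightarrow> real poly" where
  "legendre_poly l = smult (1 / (2 ^ l * fact l)) ((pderiv ^^ l) ([:-1, 0, 1:] ^ l))"

text \<open>Y_l^m for m \<ge> 0, evaluated at a point x of the unit sphere:
  Y_l^m = N_{lm} P_l^m(cos theta) e^(i m phi), with Condon-Shortley phase
  P_l^m(t) = (-1)^m (1-t^2)^(m/2) P_l^(m)(t); using sin theta e^(i phi) = x1 + i x2.\<close>
definition sph_harm_nonneg :: "nat \<Rightarrow> nat \<Rightarrow> real^3 \<Rightarrow> complex" where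
  "sph_harm_nonneg l m x =
     complex_of_real (sqrt ((2 * real l + 1) / (4 * pi) * (fact (l - m) / fact (l + m)))) *
     (-1) ^ m * (complex_of_real (x $ 1) + \<i> * complex_of_real (x $ 2)) ^ m *
     complex_of_real (poly ((pderiv ^^ m) (legendre_poly l)) (x $ 3))"

definition sph_harm :: "nat \<Rightarrow> int \<Rightarrow> real^3 \<Rightarrow> complex" where
  "sph_harm l m x = (if 0 \<le> m then sph_harm_nonneg l (nat m) x
                     else (-1) ^ nat (- m) * cnj (sph_harm_nonneg l (nat (- m)) x))"

definition has_laplacian :: "(real^3 \<Rightarrow> complex) \<Rightarrow> complex \<Rightarrow> real^3 \<Rightarrow> bool" where
  "has_laplacian f L x \<longleftrightarrow>
     (\<exists>g :: 3 \<Rightarrow> real^3 \<Rightarrow> complex. \<exists>U. open U \<and> x \<in> U \<and>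
        (\<forall>i. \<forall>y\<in>U. ((\<lambda>s. f (y + s *\<^sub>R axis i 1)) has_vector_derivative g i y) (at 0)) \<and>
        (\<exists>d :: 3 \<Rightarrow> complex.
           (\<forall>i. ((\<lambda>s. g i (x + s *\<^sub>R axis i 1)) has_vector_derivative d i) (at 0)) \<and>
           L = (\<Sum>i\<in>UNIV. d i)))"

text \<open>Laplace-Beltrami operator on S^2: Laplacian of the 0-homogeneous extension.\<close>
definition has_sphere_laplacian :: "(real^3 \<Rightarrow> complex) \<Rightarrow> complex \<Rightarrow> real^3 \<Rightarrow> bool" where
  "has_sphere_laplacian b L \<omega> \<longleftrightarrow> has_laplacian (\<lambda>x. b (x /\<^sub>R norm x)) L \<omega>"

definition sph_pt :: "real \<Rightarrow> real \<Rightarrow> real^3" where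
  "sph_pt \<theta> \<phi> = vector [sin \<theta> * cos \<phi>, sin \<theta> * sin \<phi>, cos \<theta>]"

definition sphere_inner :: "(real^3 \<Rightarrow> complex) \<Rightarrow> (real^3 \<Rightarrow> complex) \<Rightarrow> complex" where
  "sphere_inner f g = integral (cbox (0, 0) (pi, 2 * pi))
      (\<lambda>(\<theta>, \<phi>). f (sph_pt \<theta> \<phi>) * cnj (g (sph_pt \<theta> \<phi>)) * complex_of_real (sin \<theta>))"

definition solves_linearized ::
  "real \<Rightarrow> real \<Rightarrow> real \<Rightarrow> (real \<Rightarrow> real^3 \<Rightarrow> complex) \<Rightarrow> (real \<Rightarrow> real^3 \<Rightarrow> complex) \<Rightarrow> bool" where
  "solves_linearized Ca We \<gamma> \<Psi> \<beta> \<longleftrightarrow>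
     (\<forall>t x. norm x > 1 \<longrightarrow> has_laplacian (\<Psi> t) 0 x) \<and>
     (\<forall>t \<omega>. norm \<omega> = 1 \<longrightarrow>
        (\<exists>d. ((\<lambda>s. \<beta> s \<omega>) has_vector_derivative d) (at t) \<and>
             ((\<lambda>r. \<Psi> t (r *\<^sub>R \<omega>)) has_vector_derivative d) (at 1 within {1..}))) \<and>
     (\<forall>t \<omega>. norm \<omega> = 1 \<longrightarrow>
        (\<exists>L. has_sphere_laplacian (\<beta> t) L \<omega> \<and>
             ((\<lambda>s. \<Psi> s \<omega>) has_vector_derivative
                (complex_of_real (3 * \<gamma> * (Ca / 2 + 2 / We)) * sphere_inner (\<beta> t) (sph_harm 0 0)
                   * sph_harm 0 0 \<omega>
                 - complex_of_real (1 / We) * (2 * \<beta> t \<omega> + L))) (at t)))"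

end

theory Submission
  imports Defs "HOL-Library.Landau_Symbols"
begin

text \<open>
  With \<open>w = -iz\<close> the Hankel function is \<open>e^(-w) w^(-l-1) P(w)\<close> up to a constant, where \<open>P\<close> is
  the reverse Bessel polynomial, so \<open>G_l(z) = -w - (l+1) + w P'(w)/P(w)\<close> is analytic near 0. The
  Bessel equation makes the Wronskian of \<open>e^(-w) P(w)\<close> and \<open>e^w P(-w)\<close> a multiple of \<open>w^(2l)\<close>,
  which gives \<open>Im G_l(x) = x^(2l+1) / |P(-ix)|^2\<close> for real \<open>x\<close>; this term,
  of high order in \<open>x\<close>, is the radiation damping. A resonance near \<open>\<Lambda> = sqrt (r (l+1))\<close> is a Brouwer fixed point of
  \<open>\<lambda> \<mapsto> csqrt (-r G_l(\<epsilon>\<lambda>))\<close>, its expansion is read off by separating real and imaginary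
  parts, and the second resonance is its reflection \<open>-cnj \<lambda>\<close>.

  For the incompressible modes, functions \<open>(x1 + i x2)^k r^c q(x3/r)\<close> are closed under
  differentiation up to linear factors, and their Laplacian reduces to the associated Legendre
  operator applied to \<open>q\<close>; this yields both the exterior harmonicity of \<open>\<Psi>\<close> and the eigenvalue of
  \<open>\<beta>\<close> on the sphere.
\<close>

section \<open>The reverse Bessel polynomial and the Hankel logarithmic derivative\<close>

text \<open>The damping in \<open>Gfun\<close> has order 2l+1 in its argument, beyond the quartic
  error of the Taylor expansion, so imaginary parts of that expansion do not reveal it. Hence three
  separate estimates: the expansion itself, the leading imaginary term on the real axis, and a
  comparison of \<open>Gfun l z\<close> with \<open>Gfun l (Re z)\<close> at cost
  \<open>norm z\<close> times |Im z|. For z = \<open>\<epsilon> * lam\<close> that cost is of order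
  \<epsilon>^2 |v| with v = Im lam, and the left side of 2uv = -r Im G absorbs it, which bounds v
  with no prior knowledge of its size. The real part closes by a bootstrap: bounded, then accurate
  to \<epsilon>^2, then to \<epsilon>^4. No root is tracked in \<epsilon>: for each \<epsilon> some
  fixed point is chosen, and its asymptotics follow from the equation and from its lying in a fixed
  disc around \<Lambda>. The constant 2^l l! / (2l)! of the damping is 1/P(0). For the modes a
  single formula serves twice: the Laplacian of r^a Y is (a(a+1) - l(l+1)) r^(a-2) Y, which is zero
  for a = -l-1 and gives the sphere eigenvalue for a = 0.\<close>

definition bessel_coeff :: "nat \<Rightarrow> nat \<Rightarrow> complex" where
  "bessel_coeff l j =
     (if j \<le> l then fact (2 * l - j) / (fact (l - j) * fact j * 2 ^ (l - j)) else 0)"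

definition bessel_poly :: "nat \<Rightarrow> complex poly" where
  "bessel_poly l = (\<Sum>j\<le>l. monom (bessel_coeff l j) j)"

lemma coeff_bessel_poly [simp]: "coeff (bessel_poly l) j = bessel_coeff l j"
  by (auto simp: bessel_poly_def coeff_sum bessel_coeff_def)

text \<open>The differential equation of P in coefficients. The cut-off in
  \<open>bessel_coeff\<close> makes it hold for every j: at j = l the factor l - j on the right
  vanishes together with the next coefficient.\<close>

lemma bessel_coeff_Suc:
  "(of_nat j + 1) * (2 * of_nat l - of_nat j) * bessel_coeff l (Suc j)
     = 2 * (of_nat l - of_nat j) * bessel_coeff l j"
proof (cases "j < l")
  case True
  then obtain d where l: "l = j + Suc d"
    using less_imp_Suc_add by fastforce
  have e: "2 * l - j = Suc (j + 2 * d + 1)" "2 * l - Suc j = j + 2 * d + 1"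
    "l - j = Suc d" "l - Suc j = d"
    using l by auto
  have n: "2 * of_nat l - of_nat j = (of_nat (Suc (j + 2 * d + 1)) :: complex)"
    "of_nat l - of_nat j = (of_nat (Suc d) :: complex)"
    using l by auto
  have nz: "(of_nat j + 1 :: complex) \<noteq> 0" "(of_nat (Suc d) :: complex) \<noteq> 0"
    "(fact j :: complex) \<noteq> 0" "(fact d :: complex) \<noteq> 0"
    using of_nat_neq_0[where 'a=complex] by (auto simp: add.commute)
  have c: "bessel_coeff l (Suc j) = fact (j + 2 * d + 1) / (fact d * ((of_nat j + 1) * fact j) * 2 ^ d)"
    "bessel_coeff l j = of_nat (Suc (j + 2 * d + 1)) * fact (j + 2 * d + 1)
        / (of_nat (Suc d) * fact d * fact j * (2 * 2 ^ d))"
    using True unfolding bessel_coeff_def e by (simp_all add: add.commute)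
  show ?thesis
    unfolding n c using nz by (simp add: divide_simps del: of_nat_Suc)
next
  case False
  then show ?thesis by (cases "j = l") (auto simp: bessel_coeff_def)
qed

text \<open>What the spherical Bessel equation becomes once the factor e^(-w) w^(-l-1) is split off.
  In each degree it is the two-term recurrence above.\<close>

lemma bessel_poly_ode:
  "[:0, 1:] * pderiv (pderiv (bessel_poly l)) - 2 * [:of_nat l, 1:] * pderiv (bessel_poly l)
     + 2 * of_nat l * bessel_poly l = 0" (is "?D = 0")
proof (rule poly_eqI)
  fix n
  let ?c = "bessel_coeff l"
  have sm: "?D = pCons 0 (pderiv (pderiv (bessel_poly l)))
      - smult 2 (smult (of_nat l) (pderiv (bessel_poly l)) + pCons 0 (pderiv (bessel_poly l)))
      + smult (2 * of_nat l) (bessel_poly l)"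
    by (simp add: of_nat_poly numeral_poly algebra_simps smult_add_right)
  have "coeff ?D n = of_nat n * (of_nat n + 1) * ?c (Suc n)
      - 2 * (of_nat l * ((of_nat n + 1) * ?c (Suc n)) + of_nat n * ?c n) + 2 * of_nat l * ?c n"
    unfolding sm by (cases n) (simp_all add: coeff_pderiv algebra_simps)
  also have "\<dots> = 0"
    using bessel_coeff_Suc[of n l] by (simp add: algebra_simps)
  finally show "coeff ?D n = coeff 0 n" by simp
qed

text \<open>The left side D is the Wronskian of e^(-w) P(w) and e^w P(-w), where the exponentials
  cancel. The two differential equations give w D' = 2l D, so D is a monomial of degree 2l, and its
  coefficient is read off at the top.\<close>

lemma bessel_poly_wronskian:
  fixes l :: nat
  defines "P \<equiv> bessel_poly l" and "Q \<equiv> pcompose (bessel_poly l) [:0, -1:]"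
  shows "pderiv P * Q - P * pderiv Q - 2 * P * Q = monom (- 2 * (-1) ^ l) (2 * l)" (is "?D = _")
proof -
  let ?X = "[:0, 1:] :: complex poly"
  have P2: "?X * pderiv (pderiv P) = 2 * (?X + of_nat l) * pderiv P - 2 * of_nat l * P"
    using bessel_poly_ode[of l] unfolding P_def
    by (simp add: algebra_simps of_nat_poly)
  have dQ: "pderiv Q = - pcompose (pderiv P) [:0, -1:]"
    by (simp add: Q_def P_def pderiv_pcompose pderiv_pCons)
  have d2Q: "pderiv (pderiv Q) = pcompose (pderiv (pderiv P)) [:0, -1:]"
    unfolding dQ by (simp add: pderiv_minus pderiv_pcompose pderiv_pCons)
  \<comment> \<open>The equation of P evaluated at -x: the first derivative of Q picks up a sign,
    the second does not.\<close>
  have Q2: "?X * pderiv (pderiv Q) = 2 * (of_nat l - ?X) * pderiv Q + 2 * of_nat l * Q"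
  proof (rule poly_ext)
    fix x
    have "poly (?X * pderiv (pderiv P)) (- x)
        = poly (2 * (?X + of_nat l) * pderiv P - 2 * of_nat l * P) (- x)"
      by (simp only: P2)
    then show "poly (?X * pderiv (pderiv Q)) x
        = poly (2 * (of_nat l - ?X) * pderiv Q + 2 * of_nat l * Q) x"
      unfolding d2Q unfolding dQ unfolding Q_def P_def
      by (simp add: poly_pcompose algebra_simps)
  qed
  have "?X * pderiv ?D = (?X * pderiv (pderiv P)) * Q - P * (?X * pderiv (pderiv Q))
      - 2 * ?X * pderiv P * Q - 2 * ?X * P * pderiv Q"
    by (simp add: pderiv_mult pderiv_diff pderiv_add algebra_simps)
  also have "\<dots> = 2 * of_nat l * ?D"
    unfolding P2 Q2 by (simp add: algebra_simps)
  finally have ode: "?X * pderiv ?D = 2 * of_nat l * ?D" .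
  \<comment> \<open>In coefficients, w D' = 2l D says (n - 2l) d_n = 0.\<close>
  have z: "coeff ?D n = 0" if "n \<noteq> 2 * l" for n
  proof -
    have "coeff (?X * pderiv ?D) n = of_nat n * coeff ?D n"
      by (cases n) (simp_all add: coeff_pderiv)
    moreover have "2 * of_nat l * ?D = smult (of_nat (2 * l)) ?D"
      by (simp add: of_nat_poly numeral_poly mult.commute)
    ultimately have "of_nat n * coeff ?D n = of_nat (2 * l) * coeff ?D n"
      using ode by (metis coeff_smult)
    then show ?thesis using that by (metis mult_cancel_right of_nat_eq_iff)
  qed
  \<comment> \<open>Only -2PQ reaches degree 2l; P is monic and Q has leading coefficient
    (-1)^l.\<close>
  have top: "coeff ?D (2 * l) = - 2 * (-1) ^ l"
  proof -
    have cP: "coeff P l = 1" by (simp add: P_def bessel_coeff_def)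
    have "degree P \<le> l"
      by (rule degree_le) (simp add: P_def bessel_coeff_def)
    then have dP: "degree P = l"
      using cP by (intro antisym le_degree) auto
    then have dQ: "degree Q = l"
      by (simp add: Q_def P_def degree_pcompose)
    have cQ: "coeff Q l = (-1) ^ l" using cP by (simp add: Q_def P_def coeff_pcompose_linear)
    have "coeff (P * Q) (2 * l) = (-1) ^ l"
      using coeff_mult_degree_sum[of P Q] by (simp add: dP dQ cP cQ mult_2)
    moreover have "coeff (pderiv P * Q) (2 * l) = 0 \<and> coeff (P * pderiv Q) (2 * l) = 0"
    \<comment> \<open>For l = 0 the degree count would need a degree below 0; there both derivatives
      are zero.\<close>
    proof (cases "l = 0")
      case True
      then show ?thesis
        using dP dQ pderiv_eq_0_iff[of P] pderiv_eq_0_iff[of Q] by simp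
    next
      case False
      then have "degree (pderiv P * Q) < 2 * l" "degree (P * pderiv Q) < 2 * l"
        using degree_mult_le[of "pderiv P" Q] degree_mult_le[of P "pderiv Q"]
        by (simp_all add: dP dQ degree_pderiv)
      then show ?thesis by (simp add: coeff_eq_0)
    qed
    ultimately show ?thesis by (simp add: mult.assoc numeral_poly)
  qed
  show ?thesis
    by (rule poly_eqI) (use z top in \<open>auto simp: coeff_monom\<close>)
qed

section \<open>The logarithmic derivative in the rotated variable w = -iz\<close>

definition bessel_log_deriv :: "nat \<Rightarrow> complex \<Rightarrow> complex" where
  "bessel_log_deriv l w =
     - w - of_nat (l + 1) + w * poly (pderiv (bessel_poly l)) w / poly (bessel_poly l) w"

text \<open>Reversing the sum by k = l - j turns powers of 1/(2z) into powers of w; of the phases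
  only (-i)^(l+1) i^l = -i is left.\<close>

lemma hankel1_bessel:
  assumes "z \<noteq> 0"
  shows "hankel1 l z = - \<i> * exp (\<i> * z) / z ^ (l + 1) * poly (bessel_poly l) (- \<i> * z)"
proof -
  let ?w = "- \<i> * z"
  have rev: "(\<Sum>k\<le>l. f k) = (\<Sum>j\<le>l. f (l - j))" for f :: "nat \<Rightarrow> complex"
    by (rule sum.reindex_bij_witness[of _ "\<lambda>k. l - k" "\<lambda>k. l - k"]) auto
  have "(\<Sum>k\<le>l. \<i> ^ k * of_nat (fact (l + k)) / (of_nat (fact k) * of_nat (fact (l - k)) * (2 * z) ^ k))
      = (\<Sum>j\<le>l. \<i> ^ (l - j) * fact (2 * l - j) / (fact (l - j) * fact j * (2 * z) ^ (l - j)))"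
    unfolding rev[of "\<lambda>k. \<i> ^ k * of_nat (fact (l + k)) / (of_nat (fact k) * of_nat (fact (l - k)) * (2 * z) ^ k)"]
  proof (rule sum.cong)
    fix j assume "j \<in> {..l}"
    then have "l + (l - j) = 2 * l - j" "l - (l - j) = j" by auto
    then show "\<i> ^ (l - j) * of_nat (fact (l + (l - j))) / (of_nat (fact (l - j)) * of_nat (fact (l - (l - j))) * (2 * z) ^ (l - j))
      = \<i> ^ (l - j) * fact (2 * l - j) / (fact (l - j) * fact j * (2 * z) ^ (l - j))"
      by (simp only: of_nat_fact)
  qed simp
  also have "\<dots> = (\<Sum>j\<le>l. \<i> ^ l / z ^ l * (bessel_coeff l j * ?w ^ j))"
  proof (rule sum.cong)
    fix j assume "j \<in> {..l}"
    then have j: "j \<le> l" by simp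
    have "\<i> ^ (l - j) / z ^ (l - j) = \<i> ^ l / z ^ l * ?w ^ j"
    proof -
      have "\<i> ^ l = \<i> ^ (l - j) * \<i> ^ j" "z ^ l = z ^ (l - j) * z ^ j"
        using j by (simp_all flip: power_add)
      moreover have "\<i> ^ j * ?w ^ j = z ^ j"
        by (subst power_mult_distrib[symmetric]) simp
      ultimately show ?thesis using assms by (simp add: field_simps)
    qed
    moreover have "\<i> ^ (l - j) * fact (2 * l - j) / (fact (l - j) * fact j * (2 * z) ^ (l - j))
        = bessel_coeff l j * (\<i> ^ (l - j) / z ^ (l - j))"
      using j by (simp add: bessel_coeff_def power_mult_distrib mult_ac)
    ultimately show "\<i> ^ (l - j) * fact (2 * l - j) / (fact (l - j) * fact j * (2 * z) ^ (l - j))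
        = \<i> ^ l / z ^ l * (bessel_coeff l j * ?w ^ j)"
      by (simp only: mult_ac)
  qed simp
  also have "\<dots> = \<i> ^ l / z ^ l * poly (bessel_poly l) ?w"
    by (simp add: bessel_poly_def poly_sum poly_monom sum_distrib_left)
  finally have eq: "hankel1 l z = (-\<i>) ^ (l + 1) * exp (\<i> * z) / z * (\<i> ^ l / z ^ l * poly (bessel_poly l) ?w)"
    unfolding hankel1_def by simp
  have "(-\<i>) ^ (l + 1) * \<i> ^ l = - \<i>"
    unfolding power_add by (subst mult.commute, subst mult.assoc[symmetric],
        subst power_mult_distrib[symmetric]) simp
  then show ?thesis unfolding eq by (simp add: field_simps)
qed

text \<open>z d/dz equals w d/dw, so for z nonzero this is the logarithmic derivative of the closed
  form. At z = 0 the right side is -(l+1), in agreement with the convention in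
  \<open>Gfun_def\<close>.\<close>

lemma Gfun_bessel:
  assumes "poly (bessel_poly l) (- \<i> * z) \<noteq> 0"
  shows "Gfun l z = bessel_log_deriv l (- \<i> * z)"
proof (cases "z = 0")
  case True
  then show ?thesis by (simp add: Gfun_def bessel_log_deriv_def)
next
  case False
  let ?f = "\<lambda>z. - \<i> * exp (\<i> * z) / z ^ (l + 1) * poly (bessel_poly l) (- \<i> * z)"
  let ?P = "poly (bessel_poly l) (- \<i> * z)" and ?P' = "poly (pderiv (bessel_poly l)) (- \<i> * z)"
  let ?E = "- \<i> * exp (\<i> * z)"
  let ?d = "(\<i> * ?E * z ^ (l + 1) - ?E * (of_nat (l + 1) * z ^ l)) / (z ^ (l + 1) * z ^ (l + 1)) * ?P
       + ?P' * (- \<i>) * (?E / z ^ (l + 1))"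
  have "(?f has_field_derivative ?d) (at z)"
  proof -
    have 1: "((\<lambda>z. - \<i> * exp (\<i> * z)) has_field_derivative \<i> * ?E) (at z)"
      by (rule derivative_eq_intros refl)+ (simp add: mult_ac)
    have 2: "((\<lambda>z. z ^ (l + 1)) has_field_derivative of_nat (l + 1) * z ^ l) (at z)"
      by (rule derivative_eq_intros refl)+ simp
    have 3: "((\<lambda>z. poly (bessel_poly l) (- \<i> * z)) has_field_derivative ?P' * (- \<i>)) (at z)"
      by (rule DERIV_chain2[OF poly_DERIV]) (auto intro!: derivative_eq_intros)
    show ?thesis
      using DERIV_mult[OF DERIV_divide[OF 1 2] 3] False by simp
  qed
  then have "(hankel1 l has_field_derivative ?d) (at z)"
    by (rule has_field_derivative_transform_within_open[of _ _ _ "- {0}"])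
      (use False hankel1_bessel in auto)
  then have "deriv (hankel1 l) z = ?d" by (rule DERIV_imp_deriv)
  then have "Gfun l z = z * ?d / (?E / z ^ (l + 1) * ?P)"
    using False by (simp add: Gfun_def hankel1_bessel)
  also have "\<dots> = bessel_log_deriv l (- \<i> * z)"
    using False assms unfolding bessel_log_deriv_def
    by (simp add: divide_simps) (simp add: algebra_simps)
  finally show ?thesis .
qed

lemma cnj_poly_bessel:
  "cnj (poly (bessel_poly l) w) = poly (bessel_poly l) (cnj w)"
  "cnj (poly (pderiv (bessel_poly l)) w) = poly (pderiv (bessel_poly l)) (cnj w)"
proof -
  have "cnj (bessel_coeff l j) = bessel_coeff l j" for j
    by (simp add: bessel_coeff_def)
  then show "cnj (poly (bessel_poly l) w) = poly (bessel_poly l) (cnj w)"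
    "cnj (poly (pderiv (bessel_poly l)) w) = poly (pderiv (bessel_poly l)) (cnj w)"
    by (simp_all add: poly_altdef coeff_pderiv)
qed

lemma bessel_log_deriv_cnj: "bessel_log_deriv l (cnj w) = cnj (bessel_log_deriv l w)"
  by (simp add: bessel_log_deriv_def cnj_poly_bessel)

lemma poly_bessel_0: "poly (bessel_poly l) 0 = fact (2 * l) / (2 ^ l * fact l)"
  by (simp add: poly_0_coeff_0 bessel_coeff_def)

text \<open>P has real coefficients and w = -ix is purely imaginary, so the conjugate of P(w) is
  P(-w). Over the denominator |P(w)|^2 the difference of the logarithmic derivative and its
  conjugate is then w times the Wronskian.\<close>

lemma Im_bessel_log_deriv:
  fixes x :: real
  assumes "poly (bessel_poly l) (- \<i> * x) \<noteq> 0"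
  shows "Im (bessel_log_deriv l (- \<i> * x)) = x ^ (2 * l + 1) / (norm (poly (bessel_poly l) (- \<i> * x)))\<^sup>2"
proof -
  let ?w = "- \<i> * complex_of_real x"
  let ?P = "poly (bessel_poly l) ?w" and ?P' = "poly (pderiv (bessel_poly l)) ?w"
  have "poly (pderiv (bessel_poly l) * pcompose (bessel_poly l) [:0, -1:]
      - bessel_poly l * pderiv (pcompose (bessel_poly l) [:0, -1:])
      - 2 * bessel_poly l * pcompose (bessel_poly l) [:0, -1:]) ?w
      = poly (monom (- 2 * (-1) ^ l) (2 * l)) ?w"
    by (simp only: bessel_poly_wronskian)
  then have w: "?P' * cnj ?P + ?P * cnj ?P' - 2 * ?P * cnj ?P = - 2 * (-1) ^ l * ?w ^ (2 * l)"
    by (simp add: poly_pcompose pderiv_pcompose pderiv_pCons poly_monom cnj_poly_bessel)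
  have nz: "cnj ?P \<noteq> 0" using assms by simp
  have "2 * \<i> * Im (bessel_log_deriv l ?w) = bessel_log_deriv l ?w - cnj (bessel_log_deriv l ?w)"
    by (simp add: complex_diff_cnj mult.commute)
  also have "\<dots> = ?w * (?P' * cnj ?P + ?P * cnj ?P' - 2 * ?P * cnj ?P) / (?P * cnj ?P)"
    using assms nz unfolding bessel_log_deriv_def
    by (simp add: divide_simps) (simp add: algebra_simps)
  also have "\<dots> = ?w * (- 2 * (-1) ^ l * ?w ^ (2 * l)) / (norm ?P)\<^sup>2"
    unfolding w by (simp only: complex_norm_square)
  also have "?w ^ (2 * l) = (-1) ^ l * complex_of_real x ^ (2 * l)"
  proof -
    have "?w\<^sup>2 = (-1) * (complex_of_real x)\<^sup>2" by (simp add: power_mult_distrib)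
    then show ?thesis unfolding power_mult by (simp only: power_mult_distrib)
  qed
  also have "?w * (- 2 * (-1) ^ l * ((-1) ^ l * complex_of_real x ^ (2 * l))) / (norm ?P)\<^sup>2
      = 2 * \<i> * complex_of_real (x ^ (2 * l + 1) / (norm ?P)\<^sup>2)"
    by (simp add: mult_ac)
  finally show ?thesis
    by (metis mult_left_cancel complex_i_not_zero mult_eq_0_iff of_real_eq_iff zero_neq_numeral)
qed

section \<open>Estimates for \<open>Gfun\<close> near the origin\<close>

text \<open>States -w + w P'/P = -w^2/(2l-1) + O(w^4) with the denominator cleared. The cubic
  coefficient cancels only from l = 2 on: for l = 1 the damping term itself is cubic.\<close>

lemma bessel_poly_factor4:
  assumes "l \<ge> 2"
  obtains R where "[:0, 1:] * pderiv (bessel_poly l) - [:0, 1:] * bessel_poly l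
     + smult (1 / (2 * of_nat l - 1)) ([:0, 0, 1:] * bessel_poly l) = monom 1 4 * R"
proof -
  let ?D = "[:0, 1:] * pderiv (bessel_poly l) - [:0, 1:] * bessel_poly l
     + smult (1 / (2 * of_nat l - 1)) ([:0, 0, 1:] * bessel_poly l)"
  let ?c = "bessel_coeff l"
  have c1: "?c 1 = ?c 0"
    using bessel_coeff_Suc[of 0 l] assms by simp
  have n2: "2 * of_nat l - 1 \<noteq> (0 :: complex)" "of_nat l - 1 \<noteq> (0 :: complex)"
  proof -
    have "2 * of_nat l - 1 = (of_nat (2 * l - 1) :: complex)" "of_nat l - 1 = (of_nat (l - 1) :: complex)"
      using assms by (simp_all add: of_nat_diff)
    then show "2 * of_nat l - 1 \<noteq> (0 :: complex)" "of_nat l - 1 \<noteq> (0 :: complex)"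
      using assms by (simp_all del: of_nat_diff)
  qed
  have "2 * ((2 * of_nat l - 1) * ?c 2) = 2 * ((of_nat l - 1) * ?c 0)"
    using bessel_coeff_Suc[of 1 l] c1 unfolding Suc_1 by (simp add: algebra_simps)
  then have "(2 * of_nat l - 1) * ?c 2 = (of_nat l - 1) * ?c 0"
    by (subst (asm) mult_left_cancel) auto
  then have c2: "?c 2 = (of_nat l - 1) / (2 * of_nat l - 1) * ?c 0"
    using n2 by (simp add: field_simps)
  have "2 * ((of_nat l - 1) * (3 * ?c 3)) = 2 * ((of_nat l - 2) * ?c 2)"
    using bessel_coeff_Suc[of 2 l] by (simp add: algebra_simps)
  then have "(of_nat l - 1) * (3 * ?c 3) = (of_nat l - 2) * ?c 2"
    by (subst (asm) mult_left_cancel) auto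
  then have c3: "3 * ?c 3 = (of_nat l - 2) / (of_nat l - 1) * ?c 2"
    using n2 by (simp add: field_simps)
  have k2: "2 * ?c 2 - ?c 1 + ?c 0 / (2 * of_nat l - 1) = 0"
    unfolding c1 c2 using n2 by (simp add: divide_simps) (simp add: algebra_simps)
  have "3 * ?c 3 - ?c 2 + ?c 1 / (2 * of_nat l - 1) = 0"
    unfolding c3 c1 c2 using n2 by (simp add: divide_simps) (simp add: algebra_simps)
  moreover have cf: "coeff ?D (Suc (Suc n))
      = of_nat (Suc (Suc n)) * ?c (Suc (Suc n)) - ?c (Suc n) + ?c n / (2 * of_nat l - 1)" for n
    by (simp add: coeff_pderiv)
  ultimately have k3: "coeff ?D 3 = 0"
    using cf[of 1] by (simp add: eval_nat_numeral)
  have k2': "coeff ?D 2 = 0"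
    using cf[of 0] k2 by (simp add: eval_nat_numeral)
  have "coeff ?D n = 0" if "n < 4" for n
  proof -
    from that consider "n = 0" | "n = 1" | "n = 2" | "n = 3" by linarith
    then show ?thesis
      using k3 k2' c1 by cases (simp_all add: coeff_pderiv)
  qed
  then have "monom 1 4 dvd ?D" by (simp add: monom_1_dvd_iff')
  then show ?thesis using that by (elim dvdE)
qed

text \<open>P(w) P(-w) is even, so no linear term occurs. This gives the damping a relative error of
  second order in x.\<close>

lemma bessel_poly_reflect_factor2:
  obtains S where "bessel_poly l * pcompose (bessel_poly l) [:0, -1:]
    = [:(poly (bessel_poly l) 0)\<^sup>2:] + [:0, 0, 1:] * S"
proof -
  let ?Q = "pcompose (bessel_poly l) [:0, -1:]"
  let ?D = "bessel_poly l * ?Q - [:(poly (bessel_poly l) 0)\<^sup>2:]"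
  have "coeff ?D 0 = 0"
    by (simp add: coeff_mult coeff_pcompose_linear poly_0_coeff_0 power2_eq_square)
  moreover have "coeff ?D 1 = 0"
    by (simp add: coeff_mult coeff_pcompose_linear)
  ultimately have "monom 1 2 dvd ?D"
    unfolding monom_1_dvd_iff' by (metis One_nat_def less_2_cases)
  then obtain S where "?D = monom 1 2 * S" by (elim dvdE)
  then show ?thesis
    by (intro that[of S]) (simp add: monom_altdef power2_eq_square algebra_simps)
qed

text \<open>All remainders are quotients whose denominators do not vanish on a closed disc around 0,
  so compactness bounds them. In the comparison with the real axis, the factor \<open>norm z\<close>
  appears because the derivative of G vanishes at 0.\<close>

lemma Gfun_expansion:
  assumes "l \<ge> 2"
  obtains \<rho> M :: real where "\<rho> > 0" "M > 0"
    "\<And>z. norm z \<le> \<rho> \<Longrightarrow> poly (bessel_poly l) (- \<i> * z) \<noteq> 0"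
    "continuous_on (cball 0 \<rho>) (Gfun l)"
    "\<And>z. norm z \<le> \<rho> \<Longrightarrow> norm (Gfun l z + of_nat (l + 1) - z\<^sup>2 / (2 * of_nat l - 1)) \<le> M * norm z ^ 4"
    "\<And>z. norm z \<le> \<rho> \<Longrightarrow> norm (Gfun l z - Gfun l (Re z)) \<le> M * norm z * \<bar>Im z\<bar>"
    "\<And>x. \<bar>x\<bar> \<le> \<rho> \<Longrightarrow> \<bar>Im (Gfun l (complex_of_real x)) - (2 ^ l * fact l / fact (2 * l))\<^sup>2 * x ^ (2 * l + 1)\<bar>
        \<le> M * \<bar>x\<bar> ^ (2 * l + 3)"
proof -
  let ?P = "poly (bessel_poly l)" and ?P' = "poly (pderiv (bessel_poly l))"
  let ?a = "1 / (2 * of_nat l - 1) :: complex"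
  have P0: "?P 0 \<noteq> 0" by (simp add: poly_bessel_0)
  have "continuous (at 0) ?P" by simp
  from continuous_at_avoid[OF this P0] obtain e where e: "e > 0" "\<And>y. dist 0 y < e \<Longrightarrow> ?P y \<noteq> 0"
    by blast
  define \<rho> where "\<rho> = e / 2"
  have \<rho>: "\<rho> > 0" using e by (simp add: \<rho>_def)
  have nz: "?P w \<noteq> 0" if "norm w \<le> \<rho>" for w
    using e that by (auto simp: \<rho>_def dist_norm)
  obtain R where R: "[:0, 1:] * pderiv (bessel_poly l) - [:0, 1:] * bessel_poly l
     + smult ?a ([:0, 0, 1:] * bessel_poly l) = monom 1 4 * R"
    using bessel_poly_factor4[OF assms] .
  obtain S where S: "bessel_poly l * pcompose (bessel_poly l) [:0, -1:] = [:(?P 0)\<^sup>2:] + [:0, 0, 1:] * S"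
    using bessel_poly_reflect_factor2 .
  \<comment> \<open>\<open>T\<close> is the quartic remainder divided by w^4 and \<open>T'\<close>
    its derivative; w U(w) is the derivative of the whole expansion; -w^2 N(w) is the deviation of
    1/(P(w) P(-w)) from 1/P(0)^2.\<close>
  define T where "T w = poly R w / ?P w" for w
  define T' where "T' w = (poly (pderiv R) w * ?P w - poly R w * ?P' w) / (?P w * ?P w)" for w
  define U where "U w = - 2 * ?a + 4 * w\<^sup>2 * T w + w ^ 3 * T' w" for w
  define N where "N w = poly S w / ((?P 0)\<^sup>2 * (?P w * ?P (- w)))" for w
  let ?H = "bessel_log_deriv l"
  have H: "?H w = - of_nat (l + 1) - ?a * w\<^sup>2 + w ^ 4 * T w" if "norm w \<le> \<rho>" for w
  proof -
    have "poly ([:0, 1:] * pderiv (bessel_poly l) - [:0, 1:] * bessel_poly l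
     + smult ?a ([:0, 0, 1:] * bessel_poly l)) w = poly (monom 1 4 * R) w" by (simp only: R)
    then have "w * ?P' w - w * ?P w + ?a * (w\<^sup>2 * ?P w) = w ^ 4 * poly R w"
      by (simp add: poly_monom power2_eq_square algebra_simps)
    then have "w * ?P' w = w * ?P w - ?a * (w\<^sup>2 * ?P w) + w ^ 4 * poly R w"
      by (simp add: algebra_simps)
    then show ?thesis
      unfolding bessel_log_deriv_def T_def using nz[OF that]
      by (simp add: add_divide_distrib diff_divide_distrib)
  qed
  have nc: "norm (- w) \<le> \<rho>" if "norm w \<le> \<rho>" for w :: complex using that by simp
  have cont: "continuous_on (cball 0 \<rho>) T" "continuous_on (cball 0 \<rho>) U" "continuous_on (cball 0 \<rho>) N"
    unfolding U_def T_def T'_def N_def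
    by (intro continuous_intros; use nz nz[OF nc] P0 in \<open>simp\<close>)+
  have bd: "\<exists>K. \<forall>w. norm w \<le> \<rho> \<longrightarrow> norm (f w) \<le> K" if "continuous_on (cball 0 \<rho>) f" for f :: "complex \<Rightarrow> complex"
    using compact_continuous_image[OF that compact_cball] compact_imp_bounded bounded_iff
    by (metis imageI mem_cball_0)
  obtain M1 M2 M3 where M1: "\<And>w. norm w \<le> \<rho> \<Longrightarrow> norm (T w) \<le> M1"
    and M2: "\<And>w. norm w \<le> \<rho> \<Longrightarrow> norm (U w) \<le> M2"
    and M3: "\<And>w. norm w \<le> \<rho> \<Longrightarrow> norm (N w) \<le> M3"
    using bd[OF cont(1)] bd[OF cont(2)] bd[OF cont(3)] by metis
  have Mp: "M1 \<ge> 0" "M2 \<ge> 0" "M3 \<ge> 0"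
    using M1[of 0] M2[of 0] M3[of 0] \<rho> norm_ge_zero order_trans by (metis less_imp_le norm_zero)+
  define M where "M = M1 + M2 + M3 + 1"
  have G: "Gfun l z = ?H (- \<i> * z)" if "norm z \<le> \<rho>" for z
    using Gfun_bessel nz that by (simp add: norm_mult)
  have nw: "norm (- \<i> * z) = norm z" for z by (simp add: norm_mult)
  show ?thesis
  proof (rule that[of \<rho> M])
    show "\<rho> > 0" "M > 0" using \<rho> Mp by (simp_all add: M_def)
    show "?P (- \<i> * z) \<noteq> 0" if "norm z \<le> \<rho>" for z
      using nz that by (simp add: norm_mult)
    have "continuous_on (cball 0 \<rho>) (\<lambda>z. ?H (- \<i> * z))"
      unfolding bessel_log_deriv_def
      by (intro continuous_intros) (use nz in \<open>auto simp: norm_mult\<close>)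
    then show "continuous_on (cball 0 \<rho>) (Gfun l)"
      by (subst continuous_on_cong[OF refl G]) auto
    show "norm (Gfun l z + of_nat (l + 1) - z\<^sup>2 / (2 * of_nat l - 1)) \<le> M * norm z ^ 4"
      if z: "norm z \<le> \<rho>" for z
    proof -
      have "Gfun l z + of_nat (l + 1) - z\<^sup>2 / (2 * of_nat l - 1) = (- \<i> * z) ^ 4 * T (- \<i> * z)"
        unfolding G[OF z] H[OF z[folded nw[of z]]] by (simp add: power_mult_distrib)
      also have "norm \<dots> = norm z ^ 4 * norm (T (- \<i> * z))"
        by (simp add: norm_mult norm_power)
      also have "\<dots> \<le> norm z ^ 4 * M"
        using M1[of "- \<i> * z"] z Mp by (intro mult_left_mono) (auto simp: M_def norm_mult)
      finally show ?thesis by (simp add: mult.commute)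
    qed
    show "norm (Gfun l z - Gfun l (Re z)) \<le> M * norm z * \<bar>Im z\<bar>" if z: "norm z \<le> \<rho>" for z
    proof -
      let ?F = "\<lambda>w. - of_nat (l + 1) - ?a * w\<^sup>2 + w ^ 4 * T w"
      have T: "(T has_field_derivative T' w) (at w)" if "norm w \<le> \<rho>" for w
        unfolding T_def T'_def using nz[OF that] by (intro DERIV_divide poly_DERIV)
      have der: "(?F has_field_derivative w * U w) (at w within cball 0 (norm z))"
        if "w \<in> cball 0 (norm z)" for w
      proof -
        have "((\<lambda>w. - of_nat (l + 1) - c * w\<^sup>2 + w ^ 4 * T w) has_field_derivative
            w * (- 2 * c + 4 * w\<^sup>2 * T w + w ^ 3 * T' w)) (at w)" for c
          using that z
          by (auto intro!: derivative_eq_intros T simp: algebra_simps power_numeral_reduce)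
        from this[of ?a] have "(?F has_field_derivative w * U w) (at w)"
          unfolding U_def .
        then show ?thesis by (rule has_field_derivative_at_within)
      qed
      \<comment> \<open>Mean value bound on the disc of radius \<open>norm z\<close>: it contains
        both rotated points, and they lie at distance |Im z| from each other.\<close>
      have bnd: "norm (w * U w) \<le> norm z * M2" if "w \<in> cball 0 (norm z)" for w
        unfolding norm_mult using that z M2[of w] by (intro mult_mono) auto
      have r: "norm (complex_of_real (Re z)) \<le> norm z" by (simp add: abs_Re_le_cmod)
      have "norm (?F (- \<i> * z) - ?F (- \<i> * Re z)) \<le> norm z * M2 * norm (- \<i> * z - (- \<i> * Re z))"
        by (rule field_differentiable_bound[OF convex_cball der bnd])
          (use r in \<open>simp_all add: norm_mult\<close>)
      also have "norm (- \<i> * z - (- \<i> * Re z)) = \<bar>Im z\<bar>"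
      proof -
        have "- \<i> * z - (- \<i> * Re z) = complex_of_real (Im z)"
          by (simp add: complex_eq_iff)
        then show ?thesis by simp
      qed
      also have "norm z * M2 * \<bar>Im z\<bar> \<le> M * norm z * \<bar>Im z\<bar>"
        using Mp by (intro mult_right_mono) (auto simp: M_def algebra_simps)
      moreover have "Gfun l z = ?F (- \<i> * z)" "Gfun l (Re z) = ?F (- \<i> * Re z)"
        using G H z r by (simp_all add: norm_mult)
      ultimately show ?thesis by simp
    qed
    show "\<bar>Im (Gfun l (complex_of_real x)) - (2 ^ l * fact l / fact (2 * l))\<^sup>2 * x ^ (2 * l + 1)\<bar>
        \<le> M * \<bar>x\<bar> ^ (2 * l + 3)" if x: "\<bar>x\<bar> \<le> \<rho>" for x
    proof -
      let ?w = "- \<i> * complex_of_real x"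
      let ?k = "(2 ^ l * fact l / fact (2 * l))\<^sup>2 :: real"
      have w: "norm ?w \<le> \<rho>" using x by (simp add: norm_mult)
      have "poly (bessel_poly l * pcompose (bessel_poly l) [:0, -1:]) ?w = poly ([:(?P 0)\<^sup>2:] + [:0, 0, 1:] * S) ?w"
        by (simp only: S)
      then have PQ: "?P ?w * ?P (- ?w) = (?P 0)\<^sup>2 + ?w\<^sup>2 * poly S ?w"
        by (simp add: poly_pcompose power2_eq_square)
      have PP: "complex_of_real ((norm (?P ?w))\<^sup>2) = ?P ?w * ?P (- ?w)"
        unfolding complex_norm_square by (simp add: cnj_poly_bessel)
      have k: "complex_of_real ?k = 1 / (?P 0)\<^sup>2"
        by (simp add: poly_bessel_0 power_divide)
      have nPQ: "?P ?w * ?P (- ?w) \<noteq> 0"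
        using nz[OF w] nz[OF nc[OF w]] by simp
      have "complex_of_real (1 / (norm (?P ?w))\<^sup>2 - ?k) = 1 / (?P ?w * ?P (- ?w)) - 1 / (?P 0)\<^sup>2"
        by (simp only: of_real_diff of_real_divide PP k of_real_1)
      also have "\<dots> = ((?P 0)\<^sup>2 - ?P ?w * ?P (- ?w)) / ((?P 0)\<^sup>2 * (?P ?w * ?P (- ?w)))"
        using nPQ P0 by (simp add: divide_simps)
      also have "\<dots> = - ?w\<^sup>2 * N ?w"
        unfolding N_def by (subst (1) PQ) simp
      finally have "norm (complex_of_real (1 / (norm (?P ?w))\<^sup>2 - ?k)) = norm (- ?w\<^sup>2 * N ?w)" by simp
      then have d: "\<bar>1 / (norm (?P ?w))\<^sup>2 - ?k\<bar> = x\<^sup>2 * norm (N ?w)"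
        unfolding norm_of_real by (simp add: norm_mult norm_power)
      have "Im (Gfun l (complex_of_real x)) - ?k * x ^ (2 * l + 1)
          = x ^ (2 * l + 1) * (1 / (norm (?P ?w))\<^sup>2 - ?k)"
        using G[of x] x Im_bessel_log_deriv[OF nz[OF w]] by (simp add: algebra_simps)
      then have "\<bar>Im (Gfun l (complex_of_real x)) - ?k * x ^ (2 * l + 1)\<bar>
          = \<bar>x\<bar> ^ (2 * l + 1) * (\<bar>x\<bar>\<^sup>2 * norm (N ?w))"
        by (simp only: abs_mult d power_abs[symmetric] abs_power2 power2_abs)
      also have "\<dots> = \<bar>x\<bar> ^ (2 * l + 3) * norm (N ?w)"
        by (simp add: power_add eval_nat_numeral)
      also have "\<dots> \<le> \<bar>x\<bar> ^ (2 * l + 3) * M"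
        using M3[OF w] Mp by (intro mult_left_mono) (auto simp: M_def)
      finally show ?thesis by (simp add: mult.commute)
    qed
  qed
qed

text \<open>Reflection of z in the imaginary axis is conjugation of w, and P has real
  coefficients.\<close>

lemma Gfun_uminus_cnj:
  assumes "poly (bessel_poly l) (- \<i> * z) \<noteq> 0"
  shows "Gfun l (- cnj z) = cnj (Gfun l z)" "poly (bessel_poly l) (- \<i> * (- cnj z)) \<noteq> 0"
proof -
  have w: "- \<i> * (- cnj z) = cnj (- \<i> * z)" by simp
  show nz: "poly (bessel_poly l) (- \<i> * (- cnj z)) \<noteq> 0"
    unfolding w cnj_poly_bessel[symmetric] using assms by simp
  show "Gfun l (- cnj z) = cnj (Gfun l z)"
    by (simp only: Gfun_bessel[OF nz] Gfun_bessel[OF assms] w bessel_log_deriv_cnj)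
qed

text \<open>The filter is \<open>nhds 0\<close> rather than \<open>at 0\<close>, because in the
  limit equation the argument \<open>\<epsilon> * lam\<close> is constantly 0 when lam = 0.\<close>

lemma Gfun_tendsto_0: "(Gfun l \<longlongrightarrow> Gfun l 0) (nhds 0)"
proof -
  let ?P = "poly (bessel_poly l)"
  have P0: "?P 0 \<noteq> 0" by (simp add: poly_bessel_0)
  have c: "isCont (\<lambda>z. ?P (- \<i> * z)) 0" by (intro continuous_intros)
  then have "\<forall>\<^sub>F z in nhds 0. ?P (- \<i> * z) \<noteq> 0"
    using P0 by (intro tendsto_imp_eventually_ne[where c = "?P 0"]) (auto simp: isCont_def tendsto_nhds_iff)
  then have ev: "\<forall>\<^sub>F z in nhds 0. bessel_log_deriv l (- \<i> * z) = Gfun l z"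
    by eventually_elim (simp add: Gfun_bessel)
  have "isCont (\<lambda>z. bessel_log_deriv l (- \<i> * z)) 0"
    unfolding bessel_log_deriv_def by (intro continuous_intros) (use P0 in auto)
  then have "((\<lambda>z. bessel_log_deriv l (- \<i> * z)) \<longlongrightarrow> Gfun l 0) (nhds 0)"
    using Gfun_bessel[of l 0] P0 by (simp add: isCont_def tendsto_nhds_iff)
  then show ?thesis using ev by (rule Lim_transform_eventually)
qed

section \<open>Resonances near the real axis\<close>

text \<open>The two conditions on \<epsilon> keep \<open>\<epsilon> * lam\<close> in the disc where
  G is controlled, and -r G within \<Lambda>^2 / 2 of \<Lambda>^2. Its values then lie in the right
  half-plane, where \<open>csqrt\<close> is continuous.\<close>

lemma resonance_exists:
  fixes G :: "complex \<Rightarrow> complex" and r n \<rho> K \<epsilon> :: real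
  defines "\<Lambda> \<equiv> sqrt (r * n)"
  assumes "r > 0" "n > 0" "\<epsilon> > 0"
    and cont: "continuous_on (cball 0 \<rho>) G"
    and G: "\<And>z. norm z \<le> \<rho> \<Longrightarrow> norm (G z + of_real n) \<le> K * (norm z)\<^sup>2"
    and \<epsilon>: "\<epsilon> * (3 / 2 * \<Lambda>) \<le> \<rho>" "r * (K * (\<epsilon> * (3 / 2 * \<Lambda>))\<^sup>2) \<le> \<Lambda>\<^sup>2 / 2" and "K \<ge> 0"
  shows "\<exists>lam\<in>cball (of_real \<Lambda>) (\<Lambda> / 2). lam\<^sup>2 + of_real r * G (of_real \<epsilon> * lam) = 0"
proof -
  let ?S = "cball (complex_of_real \<Lambda>) (\<Lambda> / 2)"
  let ?w = "\<lambda>lam. - of_real r * G (of_real \<epsilon> * lam)"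
  have l0: "\<Lambda> > 0" "\<Lambda>\<^sup>2 = r * n"
    using assms(2,3) by (simp_all add: \<Lambda>_def)
  have nl: "norm lam \<le> 3 / 2 * \<Lambda>" if "lam \<in> ?S" for lam
  proof -
    have "norm lam \<le> norm (complex_of_real \<Lambda>) + norm (lam - of_real \<Lambda>)"
      by (metis add.commute diff_add_cancel norm_triangle_ineq)
    also have "\<dots> \<le> \<Lambda> + \<Lambda> / 2"
      using that l0 by (simp add: dist_norm norm_minus_commute)
    finally show ?thesis by simp
  qed
  have nz: "norm (of_real \<epsilon> * lam) \<le> \<epsilon> * (3 / 2 * \<Lambda>)" if "lam \<in> ?S" for lam
    using nl[OF that] \<open>\<epsilon> > 0\<close> by (simp add: norm_mult)
  have w: "norm (?w lam - of_real (\<Lambda>\<^sup>2)) \<le> \<Lambda>\<^sup>2 / 2" if "lam \<in> ?S" for lam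
  proof -
    let ?z = "of_real \<epsilon> * lam"
    have "?w lam - of_real (\<Lambda>\<^sup>2) = - of_real r * (G ?z + of_real n)"
      unfolding l0(2) by (simp add: algebra_simps)
    then have "norm (?w lam - of_real (\<Lambda>\<^sup>2)) = r * norm (G ?z + of_real n)"
      using \<open>r > 0\<close> by (simp only: norm_mult norm_minus_cancel norm_of_real abs_of_pos)
    also have "\<dots> \<le> r * (K * (\<epsilon> * (3 / 2 * \<Lambda>))\<^sup>2)"
    proof (intro mult_left_mono)
      have "norm (G ?z + of_real n) \<le> K * (norm ?z)\<^sup>2"
        using nz[OF that] \<epsilon>(1) by (intro G) linarith
      also have "\<dots> \<le> K * (\<epsilon> * (3 / 2 * \<Lambda>))\<^sup>2"
        using nz[OF that] \<open>K \<ge> 0\<close> by (intro mult_left_mono power_mono) auto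
      finally show "norm (G ?z + of_real n) \<le> K * (\<epsilon> * (3 / 2 * \<Lambda>))\<^sup>2" .
    qed (use \<open>r > 0\<close> in simp)
    finally show ?thesis using \<epsilon>(2) by linarith
  qed
  have pos: "Re (?w lam) > 0" if "lam \<in> ?S" for lam
  proof -
    have "\<bar>Re (?w lam - of_real (\<Lambda>\<^sup>2))\<bar> \<le> \<Lambda>\<^sup>2 / 2"
      using w[OF that] abs_Re_le_cmod order_trans by blast
    then have "Re (?w lam) \<ge> \<Lambda>\<^sup>2 / 2"
      unfolding minus_complex.sel Re_complex_of_real by linarith
    then show ?thesis using l0 by (smt (verit) half_gt_zero zero_less_power)
  qed
  obtain lam where lam: "lam \<in> ?S" "csqrt (?w lam) = lam"
  proof (rule brouwer[of ?S "\<lambda>lam. csqrt (?w lam)"])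
    show "compact ?S" "convex ?S" "?S \<noteq> {}" using l0 by auto
    have "continuous_on ?S (\<lambda>lam. G (of_real \<epsilon> * lam))"
    proof (rule continuous_on_compose2[OF cont])
      show "(\<lambda>lam. of_real \<epsilon> * lam) ` ?S \<subseteq> cball 0 \<rho>"
        using order_trans[OF nz \<epsilon>(1)] by (simp add: image_subset_iff)
    qed (intro continuous_intros)
    then show "continuous_on ?S (\<lambda>lam. csqrt (?w lam))"
    proof (intro continuous_on_compose2[OF continuous_on_csqrt] continuous_intros)
      have "?w lam \<notin> \<real>\<^sub>\<le>\<^sub>0" if "lam \<in> ?S" for lam
        using pos[OF that] unfolding complex_nonpos_Reals_iff by linarith
      then show "?w ` ?S \<subseteq> - \<real>\<^sub>\<le>\<^sub>0" by blast
    qed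
    show "(\<lambda>lam. csqrt (?w lam)) \<in> ?S \<rightarrow> ?S"
    proof
      fix lam assume lam: "lam \<in> ?S"
      let ?q = "csqrt (?w lam)"
      \<comment> \<open>For the image q, |q - \<Lambda>| |q + \<Lambda>| = |q^2 - \<Lambda>^2| is at
        most \<Lambda>^2 / 2, and the second factor is at least \<Lambda> because a principal root
        has nonnegative real part. So the radius \<Lambda> / 2 reproduces itself.\<close>
      have "\<Lambda> \<le> Re (?q + of_real \<Lambda>)"
        using csqrt_principal[of "?w lam"] Re_csqrt[of "?w lam"] by simp
      also have "\<dots> \<le> norm (?q + of_real \<Lambda>)" by (rule complex_Re_le_cmod)
      finally have "norm (?q - of_real \<Lambda>) * \<Lambda> \<le> norm (?q - of_real \<Lambda>) * norm (?q + of_real \<Lambda>)"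
        by (intro mult_left_mono) auto
      also have "\<dots> = norm (?q\<^sup>2 - of_real (\<Lambda>\<^sup>2))"
      proof -
        have "norm (q - c) * norm (q + c) = norm (q\<^sup>2 - c\<^sup>2)" for q c :: complex
          by (simp add: norm_mult[symmetric] power2_eq_square algebra_simps)
        then show ?thesis by (simp only: of_real_power)
      qed
      also have "\<dots> \<le> \<Lambda>\<^sup>2 / 2"
        unfolding power2_csqrt using w[OF lam] .
      finally have "norm (?q - of_real \<Lambda>) * \<Lambda> \<le> (\<Lambda> / 2) * \<Lambda>"
        by (simp add: power2_eq_square)
      then have "norm (?q - of_real \<Lambda>) \<le> \<Lambda> / 2"
        using l0(1) by (rule mult_right_le_imp_le)
      then show "?q \<in> ?S" by (simp add: dist_norm norm_minus_commute)
    qed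
  qed
  have "lam\<^sup>2 = ?w lam"
    using lam(2) power2_csqrt[of "?w lam"] by simp
  then show ?thesis using lam(1) by (intro bexI[of _ lam]) simp_all
qed

section \<open>Asymptotics of the root\<close>

text \<open>Induction through f^(k+1) - c^(k+1) = f (f^k - c^k) + (f - c) c^k.\<close>

lemma bigo_power_diff:
  fixes f :: "real \<Rightarrow> real"
  assumes "(\<lambda>x. f x - c) \<in> O[F](g)" "f \<in> O[F](\<lambda>_. 1)"
  shows "(\<lambda>x. f x ^ k - c ^ k) \<in> O[F](g)"
proof (induction k)
  case (Suc k)
  have "(\<lambda>x. f x * (f x ^ k - c ^ k)) \<in> O[F](\<lambda>x. 1 * g x)"
    by (intro landau_o.big.mult assms Suc.IH)
  moreover have "(\<lambda>x. (f x - c) * c ^ k) \<in> O[F](\<lambda>x. g x * 1)"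
    by (intro landau_o.big.mult assms) simp
  ultimately have "(\<lambda>x. f x * (f x ^ k - c ^ k) + (f x - c) * c ^ k) \<in> O[F](g)"
    by (intro sum_in_bigo) simp_all
  then show ?case by (simp add: algebra_simps)
qed simp

lemma bigo_power_mono_at_right_0:
  assumes "m \<le> n"
  shows "(\<lambda>x::real. x ^ n) \<in> O[at_right 0](\<lambda>x. x ^ m)"
proof (rule bigoI[of _ 1])
  show "\<forall>\<^sub>F x::real in at_right 0. norm (x ^ n) \<le> 1 * norm (x ^ m)"
    unfolding eventually_at_right_field
    by (rule exI[of _ 1]) (use assms in \<open>auto intro!: power_decreasing\<close>)
qed

text \<open>G is abstract so that only the three estimates enter. The leading values are u^2 = r n
  and, from 2uv = -r Im G with Im G close to \<kappa> (\<epsilon> u)^(2l+1), v = -(r \<kappa> / 2)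
  \<epsilon>^(2l+1) u^(2l).\<close>

lemma resonance_expansion:
  fixes G :: "complex \<Rightarrow> complex" and r \<kappa> \<rho> M :: real and l :: nat
  defines "n \<equiv> real l + 1" and "a \<equiv> 1 / (2 * real l - 1)"
  defines "\<Lambda> \<equiv> sqrt (r * n)"
  assumes l: "l \<ge> 2" and r: "r > 0" and \<rho>: "\<rho> > 0" and M: "M > 0"
    and cont: "continuous_on (cball 0 \<rho>) G"
    and G1: "\<And>z. norm z \<le> \<rho> \<Longrightarrow> norm (G z + of_real n - of_real a * z\<^sup>2) \<le> M * norm z ^ 4"
    and G2: "\<And>z. norm z \<le> \<rho> \<Longrightarrow> norm (G z - G (Re z)) \<le> M * norm z * \<bar>Im z\<bar>"
    and G3: "\<And>x. \<bar>x\<bar> \<le> \<rho> \<Longrightarrow> \<bar>Im (G (of_real x)) - \<kappa> * x ^ (2 * l + 1)\<bar> \<le> M * \<bar>x\<bar> ^ (2 * l + 3)"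
  shows "\<exists>\<epsilon>0>0. \<exists>C. \<forall>\<epsilon>. 0 < \<epsilon> \<and> \<epsilon> \<le> \<epsilon>0 \<longrightarrow> (\<exists>lam. norm (of_real \<epsilon> * lam) \<le> \<rho> \<and> Re lam > 0 \<and>
      lam\<^sup>2 + of_real r * G (of_real \<epsilon> * lam) = 0 \<and>
      \<bar>Re lam / \<Lambda> - (1 - r * a * \<epsilon>\<^sup>2 / 2)\<bar> \<le> C * \<epsilon> ^ 4 \<and>
      \<bar>\<epsilon> * Im lam + \<kappa> / 2 * r ^ (l + 1) * n ^ l * \<epsilon> ^ (2 * l + 2)\<bar> \<le> C * \<epsilon> ^ (2 * l + 4))"
proof -
  have n: "n > 0" and a: "a > 0" using l by (simp_all add: n_def a_def)
  have l0: "\<Lambda> > 0" "\<Lambda>\<^sup>2 = r * n" using r n by (simp_all add: \<Lambda>_def)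
  define K where "K = a + M * \<rho>\<^sup>2"
  have K: "K > 0" using a M \<rho> by (simp add: K_def add_pos_pos)
  \<comment> \<open>A crude quadratic bound suffices for the fixed point: on the disc the quartic
    term is at most M \<rho>^2 times the square of \<open>norm z\<close>.\<close>
  have GK: "norm (G z + of_real n) \<le> K * (norm z)\<^sup>2" if z: "norm z \<le> \<rho>" for z
  proof -
    have "norm (G z + of_real n) \<le> norm (G z + of_real n - of_real a * z\<^sup>2) + norm (of_real a * z\<^sup>2)"
      by (metis diff_add_cancel norm_triangle_ineq)
    also have "\<dots> \<le> M * norm z ^ 4 + a * (norm z)\<^sup>2"
      using G1[OF z] a by (simp add: norm_mult norm_power)
    also have "M * norm z ^ 4 = M * (norm z)\<^sup>2 * (norm z)\<^sup>2" by (simp add: power_numeral_reduce)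
    also have "\<dots> \<le> M * \<rho>\<^sup>2 * (norm z)\<^sup>2"
      using z M by (intro mult_right_mono mult_left_mono power_mono) auto
    finally show ?thesis by (simp add: K_def algebra_simps)
  qed
  let ?F = "at_right (0::real)"
  have small: "\<forall>\<^sub>F \<epsilon> in ?F. f \<epsilon> < b" if "(f \<longlongrightarrow> 0) ?F" "b > 0" for f :: "real \<Rightarrow> real" and b
    using that by (rule order_tendstoD(2))
  have s1: "\<forall>\<^sub>F \<epsilon> in ?F. \<epsilon> * (3 / 2 * \<Lambda>) < \<rho>"
    by (intro small \<rho>) (auto intro!: tendsto_eq_intros)
  have s2: "\<forall>\<^sub>F \<epsilon> in ?F. r * (K * (\<epsilon> * (3 / 2 * \<Lambda>))\<^sup>2) < \<Lambda>\<^sup>2 / 2"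
    using l0(1) by (intro small) (auto intro!: tendsto_eq_intros)
  \<comment> \<open>This smallness lets the term of order \<epsilon>^2 |v| be absorbed when v is
    bounded.\<close>
  have s3: "\<forall>\<^sub>F \<epsilon> in ?F. r * (M * (3 / 2 * \<Lambda>)) * \<epsilon>\<^sup>2 < \<Lambda> / 2"
    using l0(1) by (intro small) (auto intro!: tendsto_eq_intros)
  have s4: "\<forall>\<^sub>F \<epsilon> in ?F. r * a * \<epsilon>\<^sup>2 / 2 < 1"
    by (intro small) (auto intro!: tendsto_eq_intros)
  have ex: "\<forall>\<^sub>F \<epsilon> in ?F. \<exists>lam\<in>cball (of_real \<Lambda>) (\<Lambda> / 2). lam\<^sup>2 + of_real r * G (of_real \<epsilon> * lam) = 0"
    using s1 s2 eventually_at_right_less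
  proof eventually_elim
    case (elim \<epsilon>)
    then show ?case
      using resonance_exists[of r n \<epsilon> \<rho> G K] r n cont GK K by (simp add: \<Lambda>_def)
  qed
  define lam where "lam \<epsilon> = (SOME lam. lam \<in> cball (of_real \<Lambda>) (\<Lambda> / 2) \<and> lam\<^sup>2 + of_real r * G (of_real \<epsilon> * lam) = 0)" for \<epsilon>
  define u where "u \<epsilon> = Re (lam \<epsilon>)" for \<epsilon>
  define v where "v \<epsilon> = Im (lam \<epsilon>)" for \<epsilon>
  have lam: "\<forall>\<^sub>F \<epsilon> in ?F. lam \<epsilon> \<in> cball (of_real \<Lambda>) (\<Lambda> / 2) \<and> (lam \<epsilon>)\<^sup>2 + of_real r * G (of_real \<epsilon> * lam \<epsilon>) = 0"
    using ex unfolding Bex_def lam_def by eventually_elim (rule someI_ex)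
  have base: "\<forall>\<^sub>F \<epsilon> in ?F. \<epsilon> > 0 \<and> norm (lam \<epsilon>) \<le> 3 / 2 * \<Lambda> \<and> norm (of_real \<epsilon> * lam \<epsilon>) \<le> \<rho>
      \<and> \<Lambda> / 2 \<le> u \<epsilon> \<and> \<bar>u \<epsilon>\<bar> \<le> 3 / 2 * \<Lambda> \<and> \<bar>\<epsilon> * u \<epsilon>\<bar> \<le> \<rho>
      \<and> (lam \<epsilon>)\<^sup>2 = - of_real r * G (of_real \<epsilon> * lam \<epsilon>)"
    using lam s1 eventually_at_right_less
  proof eventually_elim
    case (elim \<epsilon>)
    then have d: "norm (lam \<epsilon> - of_real \<Lambda>) \<le> \<Lambda> / 2" by (simp add: dist_norm norm_minus_commute)
    have "norm (lam \<epsilon>) \<le> norm (complex_of_real \<Lambda>) + norm (lam \<epsilon> - of_real \<Lambda>)"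
      by (metis add.commute diff_add_cancel norm_triangle_ineq)
    then have nl: "norm (lam \<epsilon>) \<le> 3 / 2 * \<Lambda>" using d l0 by simp
    have "\<epsilon> * norm (lam \<epsilon>) \<le> \<epsilon> * (3 / 2 * \<Lambda>)"
      using nl elim by (intro mult_left_mono) auto
    moreover have "norm (of_real \<epsilon> * lam \<epsilon>) = \<epsilon> * norm (lam \<epsilon>)" using elim by (simp add: norm_mult)
    ultimately have nr: "norm (of_real \<epsilon> * lam \<epsilon>) \<le> \<rho>" using elim by linarith
    have "\<bar>Re (lam \<epsilon> - of_real \<Lambda>)\<bar> \<le> \<Lambda> / 2" using d abs_Re_le_cmod order_trans by blast
    then have "\<Lambda> / 2 \<le> u \<epsilon>"
      unfolding minus_complex.sel Re_complex_of_real u_def by linarith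
    moreover have "\<bar>u \<epsilon>\<bar> \<le> 3 / 2 * \<Lambda>" using nl abs_Re_le_cmod[of "lam \<epsilon>"] by (simp add: u_def)
    moreover have "\<bar>\<epsilon> * u \<epsilon>\<bar> \<le> \<rho>"
      using nr abs_Re_le_cmod[of "of_real \<epsilon> * lam \<epsilon>"] by (simp add: u_def)
    ultimately show ?case using nl nr elim by (simp add: eq_neg_iff_add_eq_0)
  qed
  have uO: "u \<in> O[?F](\<lambda>_. 1)"
    by (rule bigoI[of _ "3 / 2 * \<Lambda>"]) (use base in \<open>eventually_elim, simp\<close>)
  have iuO: "(\<lambda>\<epsilon>. 1 / u \<epsilon>) \<in> O[?F](\<lambda>_. 1)"
  proof (rule bigoI[of _ "2 / \<Lambda>"])
    show "\<forall>\<^sub>F \<epsilon> in ?F. norm (1 / u \<epsilon>) \<le> 2 / \<Lambda> * norm (1::real)"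
      using base by eventually_elim (use l0 in \<open>auto simp: field_simps\<close>)
  qed
  let ?I = "\<lambda>\<epsilon>. Im (G (of_real (\<epsilon> * u \<epsilon>)))"
  have I1: "(\<lambda>\<epsilon>. ?I \<epsilon> - \<kappa> * (\<epsilon> * u \<epsilon>) ^ (2 * l + 1)) \<in> O[?F](\<lambda>\<epsilon>. \<epsilon> ^ (2 * l + 3))"
  proof (rule bigoI[of _ "M * (3 / 2 * \<Lambda>) ^ (2 * l + 3)"])
    show "\<forall>\<^sub>F \<epsilon> in ?F. norm (?I \<epsilon> - \<kappa> * (\<epsilon> * u \<epsilon>) ^ (2 * l + 1))
        \<le> M * (3 / 2 * \<Lambda>) ^ (2 * l + 3) * norm (\<epsilon> ^ (2 * l + 3))"
      using base
    proof eventually_elim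
      case (elim \<epsilon>)
      have "norm (?I \<epsilon> - \<kappa> * (\<epsilon> * u \<epsilon>) ^ (2 * l + 1)) \<le> M * \<bar>\<epsilon> * u \<epsilon>\<bar> ^ (2 * l + 3)"
        using G3[of "\<epsilon> * u \<epsilon>"] elim by simp
      also have "\<dots> \<le> M * (\<epsilon> * (3 / 2 * \<Lambda>)) ^ (2 * l + 3)"
        using elim M unfolding abs_mult by (intro mult_left_mono power_mono mult_mono) auto
      also have "\<dots> = M * (3 / 2 * \<Lambda>) ^ (2 * l + 3) * norm (\<epsilon> ^ (2 * l + 3))"
      proof -
        have "norm (\<epsilon> ^ (2 * l + 3)) = \<epsilon> ^ (2 * l + 3)" using elim by simp
        then show ?thesis by (simp only: power_mult_distrib mult_ac)
      qed
      finally show ?case .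
    qed
  qed
  have "(\<lambda>\<epsilon>. \<kappa> * (\<epsilon> ^ (2 * l + 1) * u \<epsilon> ^ (2 * l + 1))) \<in> O[?F](\<lambda>\<epsilon>. 1 * (\<epsilon> ^ (2 * l + 1) * 1 ^ (2 * l + 1)))"
    by (intro landau_o.big.mult landau_o.big_power uO) simp_all
  then have k1: "(\<lambda>\<epsilon>. \<kappa> * (\<epsilon> * u \<epsilon>) ^ (2 * l + 1)) \<in> O[?F](\<lambda>\<epsilon>. \<epsilon> ^ (2 * l + 1))"
    by (simp only: power_mult_distrib power_one mult_1 mult_1_right)
  have "(\<lambda>\<epsilon>. ?I \<epsilon> - \<kappa> * (\<epsilon> * u \<epsilon>) ^ (2 * l + 1)) \<in> O[?F](\<lambda>\<epsilon>. \<epsilon> ^ (2 * l + 1))"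
    by (rule landau_o.big.trans[OF I1 bigo_power_mono_at_right_0]) simp
  from sum_in_bigo(1)[OF this k1] have I2: "?I \<in> O[?F](\<lambda>\<epsilon>. \<epsilon> ^ (2 * l + 1))" by simp
  let ?z = "\<lambda>\<epsilon>. of_real \<epsilon> * lam \<epsilon>"
  have Idiff: "\<forall>\<^sub>F \<epsilon> in ?F. \<bar>Im (G (?z \<epsilon>)) - ?I \<epsilon>\<bar> \<le> M * (3 / 2 * \<Lambda>) * \<epsilon>\<^sup>2 * \<bar>v \<epsilon>\<bar>"
    using base
  proof eventually_elim
    case (elim \<epsilon>)
    have "\<bar>Im (G (?z \<epsilon>)) - ?I \<epsilon>\<bar> \<le> norm (G (?z \<epsilon>) - G (Re (?z \<epsilon>)))"
      using abs_Im_le_cmod[of "G (?z \<epsilon>) - G (Re (?z \<epsilon>))"] by (simp add: u_def)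
    also have "\<dots> \<le> M * norm (?z \<epsilon>) * \<bar>Im (?z \<epsilon>)\<bar>"
      by (rule G2) (use elim in blast)
    also have "\<dots> = M * norm (lam \<epsilon>) * (\<epsilon>\<^sup>2 * \<bar>v \<epsilon>\<bar>)"
      using elim by (simp add: norm_mult v_def power2_eq_square abs_mult)
    also have "\<dots> \<le> M * (3 / 2 * \<Lambda>) * (\<epsilon>\<^sup>2 * \<bar>v \<epsilon>\<bar>)"
      using elim M by (intro mult_right_mono mult_left_mono) auto
    finally show ?case by simp
  qed
  have imeq: "\<forall>\<^sub>F \<epsilon> in ?F. 2 * u \<epsilon> * v \<epsilon> = - r * Im (G (?z \<epsilon>))"
    using base
  proof eventually_elim
    case (elim \<epsilon>)
    then have "Im ((lam \<epsilon>)\<^sup>2) = Im (- of_real r * G (?z \<epsilon>))" by simp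
    then show ?case by (simp add: u_def v_def power2_eq_square mult_ac)
  qed
  have reeq: "\<forall>\<^sub>F \<epsilon> in ?F. (u \<epsilon>)\<^sup>2 - (v \<epsilon>)\<^sup>2 = - r * Re (G (?z \<epsilon>))"
    using base
  proof eventually_elim
    case (elim \<epsilon>)
    then have "Re ((lam \<epsilon>)\<^sup>2) = Re (- of_real r * G (?z \<epsilon>))" by simp
    then show ?case by (simp add: u_def v_def power2_eq_square mult_ac)
  qed
  \<comment> \<open>Absorption: 2u|v| is at most r|I| + (\<Lambda>/2)|v|, while 2u is at least
    \<Lambda>. What remains is (\<Lambda>/2)|v| on the left, whence the constant
    2r/\<Lambda>.\<close>
  have "v \<in> O[?F](?I)"
  proof (rule bigoI[of _ "2 * r / \<Lambda>"])
    show "\<forall>\<^sub>F \<epsilon> in ?F. norm (v \<epsilon>) \<le> 2 * r / \<Lambda> * norm (?I \<epsilon>)"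
      using base Idiff imeq s3
    proof eventually_elim
      case (elim \<epsilon>)
      have "\<Lambda> / 2 \<le> u \<epsilon>" using elim by blast
      then have "2 * u \<epsilon> * \<bar>v \<epsilon>\<bar> = \<bar>2 * u \<epsilon> * v \<epsilon>\<bar>" using l0(1) by (simp add: abs_mult)
      also have "\<dots> = r * \<bar>Im (G (?z \<epsilon>))\<bar>"
        unfolding elim(3) using r by (simp add: abs_mult)
      also have "\<dots> \<le> r * (\<bar>?I \<epsilon>\<bar> + M * (3 / 2 * \<Lambda>) * \<epsilon>\<^sup>2 * \<bar>v \<epsilon>\<bar>)"
        using elim(2) r by (intro mult_left_mono) linarith+
      also have "\<dots> = r * \<bar>?I \<epsilon>\<bar> + (r * (M * (3 / 2 * \<Lambda>)) * \<epsilon>\<^sup>2) * \<bar>v \<epsilon>\<bar>"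
        by (simp add: algebra_simps)
      also have "\<dots> \<le> r * \<bar>?I \<epsilon>\<bar> + (\<Lambda> / 2) * \<bar>v \<epsilon>\<bar>"
        by (intro add_left_mono mult_right_mono less_imp_le[OF elim(4)]) simp
      finally have "2 * u \<epsilon> * \<bar>v \<epsilon>\<bar> \<le> r * \<bar>?I \<epsilon>\<bar> + (\<Lambda> / 2) * \<bar>v \<epsilon>\<bar>" .
      moreover have "\<Lambda> * \<bar>v \<epsilon>\<bar> \<le> 2 * u \<epsilon> * \<bar>v \<epsilon>\<bar>"
        using \<open>\<Lambda> / 2 \<le> u \<epsilon>\<close> by (intro mult_right_mono) auto
      ultimately have "(\<Lambda> / 2) * \<bar>v \<epsilon>\<bar> \<le> r * \<bar>?I \<epsilon>\<bar>" by simp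
      then show ?case using l0 by (simp add: field_simps)
    qed
  qed
  then have vO: "v \<in> O[?F](\<lambda>\<epsilon>. \<epsilon> ^ (2 * l + 1))"
    using I2 by (rule landau_o.big.trans)
  have "(\<lambda>\<epsilon>. Im (G (?z \<epsilon>)) - ?I \<epsilon>) \<in> O[?F](\<lambda>\<epsilon>. \<epsilon>\<^sup>2 * v \<epsilon>)"
    by (rule bigoI[of _ "M * (3 / 2 * \<Lambda>)"])
      (use Idiff in \<open>eventually_elim, simp add: abs_mult mult.assoc\<close>)
  also have "(\<lambda>\<epsilon>. \<epsilon>\<^sup>2 * v \<epsilon>) \<in> O[?F](\<lambda>\<epsilon>. \<epsilon>\<^sup>2 * \<epsilon> ^ (2 * l + 1))"
    by (intro landau_o.big.mult vO) simp
  finally have I3: "(\<lambda>\<epsilon>. Im (G (?z \<epsilon>)) - ?I \<epsilon>) \<in> O[?F](\<lambda>\<epsilon>. \<epsilon> ^ (2 * l + 3))"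
    by (simp add: power_add eval_nat_numeral mult_ac)
  \<comment> \<open>The imaginary equation divided by 2u. The quotient of u^(2l+1) by u is kept as a
    power of u^2, since the real equation controls u^2.\<close>
  have "(\<lambda>\<epsilon>. (- r / 2) * ((1 / u \<epsilon>) * ((Im (G (?z \<epsilon>)) - ?I \<epsilon>) + (?I \<epsilon> - \<kappa> * (\<epsilon> * u \<epsilon>) ^ (2 * l + 1)))))
      \<in> O[?F](\<lambda>\<epsilon>. 1 * (1 * \<epsilon> ^ (2 * l + 3)))"
    by (intro landau_o.big.mult iuO sum_in_bigo I1 I3) simp
  also have "?this \<longleftrightarrow> (\<lambda>\<epsilon>. v \<epsilon> + r * \<kappa> / 2 * (\<epsilon> ^ (2 * l + 1) * ((u \<epsilon>)\<^sup>2) ^ l)) \<in> O[?F](\<lambda>\<epsilon>. 1 * (1 * \<epsilon> ^ (2 * l + 3)))"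
  proof (rule landau_o.big.in_cong)
    show "\<forall>\<^sub>F \<epsilon> in ?F. (- r / 2) * ((1 / u \<epsilon>) * ((Im (G (?z \<epsilon>)) - ?I \<epsilon>) + (?I \<epsilon> - \<kappa> * (\<epsilon> * u \<epsilon>) ^ (2 * l + 1))))
        = v \<epsilon> + r * \<kappa> / 2 * (\<epsilon> ^ (2 * l + 1) * ((u \<epsilon>)\<^sup>2) ^ l)"
      using base imeq
    proof eventually_elim
      case (elim \<epsilon>)
      then have u: "u \<epsilon> \<noteq> 0" using l0 by auto
      have "v \<epsilon> = (- r / 2) * ((1 / u \<epsilon>) * Im (G (?z \<epsilon>)))"
        using elim u by (simp add: field_simps)
      moreover have "(1 / u \<epsilon>) * (\<epsilon> * u \<epsilon>) ^ (2 * l + 1) = \<epsilon> ^ (2 * l + 1) * ((u \<epsilon>)\<^sup>2) ^ l"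
        using u by (simp add: power_mult_distrib power_mult)
      moreover have "(- r / 2) * (A * ((J - I) + (I - \<kappa> * B))) = (- r / 2) * (A * J) + r * \<kappa> / 2 * (A * B)"
        for A B I J :: real by (simp add: algebra_simps)
      ultimately show ?case by (simp only:)
    qed
  qed
  finally have V1: "(\<lambda>\<epsilon>. v \<epsilon> + r * \<kappa> / 2 * (\<epsilon> ^ (2 * l + 1) * ((u \<epsilon>)\<^sup>2) ^ l)) \<in> O[?F](\<lambda>\<epsilon>. \<epsilon> ^ (2 * l + 3))"
    by simp
  \<comment> \<open>X is the real part of lam^2, so Re (z^2) = \<epsilon>^2 X and, up to
    O(\<epsilon>^4), the real equation is linear in X.\<close>
  define X where "X \<epsilon> = (u \<epsilon>)\<^sup>2 - (v \<epsilon>)\<^sup>2" for \<epsilon>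
  have "(\<lambda>\<epsilon>. (v \<epsilon>)\<^sup>2) \<in> O[?F](\<lambda>\<epsilon>. (\<epsilon> ^ (2 * l + 1))\<^sup>2)"
    by (intro landau_o.big_power vO)
  also have "(\<lambda>\<epsilon>::real. (\<epsilon> ^ (2 * l + 1))\<^sup>2) \<in> O[?F](\<lambda>\<epsilon>. \<epsilon> ^ 4)"
    using l unfolding power_mult[symmetric] by (intro bigo_power_mono_at_right_0) simp
  finally have v2: "(\<lambda>\<epsilon>. (v \<epsilon>)\<^sup>2) \<in> O[?F](\<lambda>\<epsilon>. \<epsilon> ^ 4)" .
  have p42: "(\<lambda>\<epsilon>::real. \<epsilon> ^ 4) \<in> O[?F](\<lambda>\<epsilon>. \<epsilon>\<^sup>2)" and p40: "(\<lambda>\<epsilon>::real. \<epsilon> ^ 4) \<in> O[?F](\<lambda>_. 1)"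
    using bigo_power_mono_at_right_0[of 2 4] bigo_power_mono_at_right_0[of 0 4] by simp_all
  have u2: "(\<lambda>\<epsilon>. (u \<epsilon>)\<^sup>2) \<in> O[?F](\<lambda>_. 1)"
    using landau_o.big_power[OF uO, of 2] by simp
  have XO: "X \<in> O[?F](\<lambda>_. 1)"
    unfolding X_def by (intro sum_in_bigo u2 landau_o.big.trans[OF v2 p40])
  have X1: "(\<lambda>\<epsilon>. X \<epsilon> - r * n + r * a * (\<epsilon>\<^sup>2 * X \<epsilon>)) \<in> O[?F](\<lambda>\<epsilon>. \<epsilon> ^ 4)"
  proof (rule bigoI[of _ "r * (M * (3 / 2 * \<Lambda>) ^ 4)"])
    show "\<forall>\<^sub>F \<epsilon> in ?F. norm (X \<epsilon> - r * n + r * a * (\<epsilon>\<^sup>2 * X \<epsilon>)) \<le> r * (M * (3 / 2 * \<Lambda>) ^ 4) * norm (\<epsilon> ^ 4)"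
      using base reeq
    proof eventually_elim
      case (elim \<epsilon>)
      let ?e = "G (?z \<epsilon>) + of_real n - of_real a * (?z \<epsilon>)\<^sup>2"
      have "Re ((?z \<epsilon>)\<^sup>2) = \<epsilon>\<^sup>2 * X \<epsilon>"
        by (simp add: X_def u_def v_def power2_eq_square algebra_simps)
      then have "Re ?e = Re (G (?z \<epsilon>)) + n - a * (\<epsilon>\<^sup>2 * X \<epsilon>)" by simp
      moreover have "X \<epsilon> = - r * Re (G (?z \<epsilon>))"
        using elim(2) by (simp only: X_def)
      moreover have "x = - r * g \<Longrightarrow> e = g + n - a * y \<Longrightarrow> x - r * n + r * a * y = - r * e"
        for x g e y :: real by (hypsubst, simp add: algebra_simps)
      ultimately have "X \<epsilon> - r * n + r * a * (\<epsilon>\<^sup>2 * X \<epsilon>) = - r * Re ?e"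
        by blast
      then have "norm (X \<epsilon> - r * n + r * a * (\<epsilon>\<^sup>2 * X \<epsilon>)) = r * \<bar>Re ?e\<bar>"
        using r by (simp add: abs_mult)
      also have "\<dots> \<le> r * norm ?e" using r by (intro mult_left_mono abs_Re_le_cmod) auto
      also have "\<dots> \<le> r * (M * norm (?z \<epsilon>) ^ 4)"
        by (intro mult_left_mono G1) (use elim r in auto)
      also have "\<dots> \<le> r * (M * (\<epsilon> * (3 / 2 * \<Lambda>)) ^ 4)"
        using elim r M by (intro mult_left_mono power_mono) (auto simp: norm_mult)
      also have "\<dots> = r * (M * (3 / 2 * \<Lambda>) ^ 4) * norm (\<epsilon> ^ 4)"
        unfolding power_mult_distrib by simp
      finally show ?case .
    qed
  qed
  \<comment> \<open>Bootstrap: boundedness of X turns \<open>X1\<close> into X - r n =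
    O(\<epsilon>^2); putting this back into the term r a \<epsilon>^2 X leaves an error
    O(\<epsilon>^4).\<close>
  have e2X: "(\<lambda>\<epsilon>. r * a * (\<epsilon>\<^sup>2 * X \<epsilon>)) \<in> O[?F](\<lambda>\<epsilon>. 1 * (\<epsilon>\<^sup>2 * 1))"
    by (intro landau_o.big.mult XO) simp_all
  then have "(\<lambda>\<epsilon>. (X \<epsilon> - r * n + r * a * (\<epsilon>\<^sup>2 * X \<epsilon>)) - r * a * (\<epsilon>\<^sup>2 * X \<epsilon>)) \<in> O[?F](\<lambda>\<epsilon>. \<epsilon>\<^sup>2)"
    by (intro sum_in_bigo landau_o.big.trans[OF X1 p42]) simp
  then have X2: "(\<lambda>\<epsilon>. X \<epsilon> - r * n) \<in> O[?F](\<lambda>\<epsilon>. \<epsilon>\<^sup>2)" by simp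
  have "(\<lambda>\<epsilon>. (X \<epsilon> - r * n) + (v \<epsilon>)\<^sup>2) \<in> O[?F](\<lambda>\<epsilon>. \<epsilon>\<^sup>2)"
    by (intro sum_in_bigo X2 landau_o.big.trans[OF v2 p42])
  then have U2: "(\<lambda>\<epsilon>. (u \<epsilon>)\<^sup>2 - r * n) \<in> O[?F](\<lambda>\<epsilon>. \<epsilon>\<^sup>2)" by (simp add: X_def)
  have "(\<lambda>\<epsilon>. r * a * (\<epsilon>\<^sup>2 * (X \<epsilon> - r * n))) \<in> O[?F](\<lambda>\<epsilon>. 1 * (\<epsilon>\<^sup>2 * \<epsilon>\<^sup>2))"
    by (intro landau_o.big.mult X2) simp_all
  then have X3: "(\<lambda>\<epsilon>. r * a * (\<epsilon>\<^sup>2 * (X \<epsilon> - r * n))) \<in> O[?F](\<lambda>\<epsilon>. \<epsilon> ^ 4)"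
    by (simp add: power_numeral_reduce mult.assoc)
  \<comment> \<open>The claimed expansion. Its square is r n (1 - r a \<epsilon>^2) plus an explicit
    \<epsilon>^4 term, so the squares of u and y can be compared first; dividing by u + y, which is
    at least \<Lambda> / 2, then compares u with y.\<close>
  let ?y = "\<lambda>\<epsilon>. \<Lambda> * (1 - r * a * \<epsilon>\<^sup>2 / 2)"
  have "(\<lambda>\<epsilon>. (X \<epsilon> - r * n + r * a * (\<epsilon>\<^sup>2 * X \<epsilon>)) - r * a * (\<epsilon>\<^sup>2 * (X \<epsilon> - r * n)) + (v \<epsilon>)\<^sup>2
      - (r * n * (r * a / 2)\<^sup>2) * \<epsilon> ^ 4) \<in> O[?F](\<lambda>\<epsilon>. \<epsilon> ^ 4)"
    by (intro sum_in_bigo X1 X3 v2) simp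
  also have "(\<lambda>\<epsilon>. (X \<epsilon> - r * n + r * a * (\<epsilon>\<^sup>2 * X \<epsilon>)) - r * a * (\<epsilon>\<^sup>2 * (X \<epsilon> - r * n)) + (v \<epsilon>)\<^sup>2
      - (r * n * (r * a / 2)\<^sup>2) * \<epsilon> ^ 4) = (\<lambda>\<epsilon>. (u \<epsilon>)\<^sup>2 - (?y \<epsilon>)\<^sup>2)"
    unfolding power_mult_distrib l0(2) by (intro ext) (simp add: X_def field_simps power2_eq_square power_numeral_reduce)
  finally have U4: "(\<lambda>\<epsilon>. (u \<epsilon>)\<^sup>2 - (?y \<epsilon>)\<^sup>2) \<in> O[?F](\<lambda>\<epsilon>. \<epsilon> ^ 4)" .
  have "(\<lambda>\<epsilon>. u \<epsilon> / \<Lambda> - (1 - r * a * \<epsilon>\<^sup>2 / 2)) \<in> O[?F](\<lambda>\<epsilon>. (u \<epsilon>)\<^sup>2 - (?y \<epsilon>)\<^sup>2)"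
  proof (rule bigoI[of _ "2 / \<Lambda>\<^sup>2"])
    show "\<forall>\<^sub>F \<epsilon> in ?F. norm (u \<epsilon> / \<Lambda> - (1 - r * a * \<epsilon>\<^sup>2 / 2)) \<le> 2 / \<Lambda>\<^sup>2 * norm ((u \<epsilon>)\<^sup>2 - (?y \<epsilon>)\<^sup>2)"
      using base s4
    proof eventually_elim
      case (elim \<epsilon>)
      then have y: "?y \<epsilon> > 0" using l0 by simp
      have "u \<epsilon> / \<Lambda> - (1 - r * a * \<epsilon>\<^sup>2 / 2) = (u \<epsilon> - ?y \<epsilon>) / \<Lambda>"
        using l0(1) by (simp add: diff_divide_distrib)
      then have e: "norm (u \<epsilon> / \<Lambda> - (1 - r * a * \<epsilon>\<^sup>2 / 2)) = \<bar>u \<epsilon> - ?y \<epsilon>\<bar> / \<Lambda>"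
        using l0(1) by simp
      have "\<bar>u \<epsilon> - ?y \<epsilon>\<bar> * (\<Lambda> / 2) \<le> \<bar>u \<epsilon> - ?y \<epsilon>\<bar> * \<bar>u \<epsilon> + ?y \<epsilon>\<bar>"
        using elim y by (intro mult_left_mono) auto
      also have "\<dots> = \<bar>(u \<epsilon>)\<^sup>2 - (?y \<epsilon>)\<^sup>2\<bar>"
        unfolding abs_mult[symmetric] by (simp only: power2_eq_square algebra_simps)
      finally have "\<bar>u \<epsilon> - ?y \<epsilon>\<bar> \<le> 2 / \<Lambda> * \<bar>(u \<epsilon>)\<^sup>2 - (?y \<epsilon>)\<^sup>2\<bar>"
        using l0(1) by (simp add: pos_le_divide_eq)
      then have "\<bar>u \<epsilon> - ?y \<epsilon>\<bar> / \<Lambda> \<le> 2 / \<Lambda> * \<bar>(u \<epsilon>)\<^sup>2 - (?y \<epsilon>)\<^sup>2\<bar> / \<Lambda>"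
        using l0(1) by (intro divide_right_mono) auto
      then show ?case unfolding e by (simp add: power2_eq_square)
    qed
  qed
  then have R: "(\<lambda>\<epsilon>. u \<epsilon> / \<Lambda> - (1 - r * a * \<epsilon>\<^sup>2 / 2)) \<in> O[?F](\<lambda>\<epsilon>. \<epsilon> ^ 4)"
    using U4 by (rule landau_o.big.trans)
  \<comment> \<open>Replacing u^2 by r n in the leading term costs only a relative O(\<epsilon>^2);
    the factor \<epsilon> then produces the form of the claim.\<close>
  have "(\<lambda>\<epsilon>. r * \<kappa> / 2 * (\<epsilon> ^ (2 * l + 1) * (((u \<epsilon>)\<^sup>2) ^ l - (r * n) ^ l))) \<in> O[?F](\<lambda>\<epsilon>. 1 * (\<epsilon> ^ (2 * l + 1) * \<epsilon>\<^sup>2))"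
    by (intro landau_o.big.mult bigo_power_diff U2 u2) simp_all
  then have "(\<lambda>\<epsilon>. r * \<kappa> / 2 * (\<epsilon> ^ (2 * l + 1) * (((u \<epsilon>)\<^sup>2) ^ l - (r * n) ^ l))) \<in> O[?F](\<lambda>\<epsilon>. \<epsilon> ^ (2 * l + 3))"
    by (simp add: power_add eval_nat_numeral mult_ac)
  then have "(\<lambda>\<epsilon>. \<epsilon> * ((v \<epsilon> + r * \<kappa> / 2 * (\<epsilon> ^ (2 * l + 1) * ((u \<epsilon>)\<^sup>2) ^ l))
      - r * \<kappa> / 2 * (\<epsilon> ^ (2 * l + 1) * (((u \<epsilon>)\<^sup>2) ^ l - (r * n) ^ l)))) \<in> O[?F](\<lambda>\<epsilon>. \<epsilon> * \<epsilon> ^ (2 * l + 3))"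
    by (intro landau_o.big.mult sum_in_bigo V1) simp_all
  also have "(\<lambda>\<epsilon>. \<epsilon> * ((v \<epsilon> + r * \<kappa> / 2 * (\<epsilon> ^ (2 * l + 1) * ((u \<epsilon>)\<^sup>2) ^ l))
      - r * \<kappa> / 2 * (\<epsilon> ^ (2 * l + 1) * (((u \<epsilon>)\<^sup>2) ^ l - (r * n) ^ l))))
      = (\<lambda>\<epsilon>. \<epsilon> * v \<epsilon> + \<kappa> / 2 * r ^ (l + 1) * n ^ l * \<epsilon> ^ (2 * l + 2))"
    by (intro ext) (simp add: algebra_simps power_mult_distrib)
  also have "(\<lambda>\<epsilon>::real. \<epsilon> * \<epsilon> ^ (2 * l + 3)) = (\<lambda>\<epsilon>. \<epsilon> ^ (2 * l + 4))"
    by (intro ext) (simp add: eval_nat_numeral)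
  finally have V: "(\<lambda>\<epsilon>. \<epsilon> * v \<epsilon> + \<kappa> / 2 * r ^ (l + 1) * n ^ l * \<epsilon> ^ (2 * l + 2)) \<in> O[?F](\<lambda>\<epsilon>. \<epsilon> ^ (2 * l + 4))" .
  obtain C1 where C1: "\<forall>\<^sub>F \<epsilon> in ?F. norm (u \<epsilon> / \<Lambda> - (1 - r * a * \<epsilon>\<^sup>2 / 2)) \<le> C1 * norm (\<epsilon> ^ 4)"
    using landau_o.bigE[OF R] by blast
  obtain C2 where C2: "\<forall>\<^sub>F \<epsilon> in ?F. norm (\<epsilon> * v \<epsilon> + \<kappa> / 2 * r ^ (l + 1) * n ^ l * \<epsilon> ^ (2 * l + 2)) \<le> C2 * norm (\<epsilon> ^ (2 * l + 4))"
    using landau_o.bigE[OF V] by blast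
  have "\<forall>\<^sub>F \<epsilon> in ?F. norm (of_real \<epsilon> * lam \<epsilon>) \<le> \<rho> \<and> Re (lam \<epsilon>) > 0 \<and>
      (lam \<epsilon>)\<^sup>2 + of_real r * G (of_real \<epsilon> * lam \<epsilon>) = 0 \<and>
      \<bar>Re (lam \<epsilon>) / \<Lambda> - (1 - r * a * \<epsilon>\<^sup>2 / 2)\<bar> \<le> max C1 C2 * \<epsilon> ^ 4 \<and>
      \<bar>\<epsilon> * Im (lam \<epsilon>) + \<kappa> / 2 * r ^ (l + 1) * n ^ l * \<epsilon> ^ (2 * l + 2)\<bar> \<le> max C1 C2 * \<epsilon> ^ (2 * l + 4)"
    using base C1 C2
  proof eventually_elim
    case (elim \<epsilon>)
    have pos: "0 < \<epsilon>" using elim(1) by blast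
    then have "norm (\<epsilon> ^ 4) = \<epsilon> ^ 4" "norm (\<epsilon> ^ (2 * l + 4)) = \<epsilon> ^ (2 * l + 4)" by simp_all
    moreover have "C1 * \<epsilon> ^ 4 \<le> max C1 C2 * \<epsilon> ^ 4" "C2 * \<epsilon> ^ (2 * l + 4) \<le> max C1 C2 * \<epsilon> ^ (2 * l + 4)"
      using pos by (intro mult_right_mono; simp)+
    ultimately have "\<bar>Re (lam \<epsilon>) / \<Lambda> - (1 - r * a * \<epsilon>\<^sup>2 / 2)\<bar> \<le> max C1 C2 * \<epsilon> ^ 4"
      "\<bar>\<epsilon> * Im (lam \<epsilon>) + \<kappa> / 2 * r ^ (l + 1) * n ^ l * \<epsilon> ^ (2 * l + 2)\<bar> \<le> max C1 C2 * \<epsilon> ^ (2 * l + 4)"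
      using elim(2,3) unfolding u_def v_def real_norm_def by linarith+
    moreover have "Re (lam \<epsilon>) > 0" using elim(1) l0(1) unfolding u_def by linarith
    moreover have "norm (of_real \<epsilon> * lam \<epsilon>) \<le> \<rho>" using elim(1) by blast
    moreover have "(lam \<epsilon>)\<^sup>2 + of_real r * G (of_real \<epsilon> * lam \<epsilon>) = 0" using elim(1) by simp
    ultimately show ?case by blast
  qed
  then obtain b where "b > 0" and b: "\<And>\<epsilon>. 0 < \<epsilon> \<Longrightarrow> \<epsilon> < b \<Longrightarrow> norm (of_real \<epsilon> * lam \<epsilon>) \<le> \<rho> \<and> Re (lam \<epsilon>) > 0 \<and>
      (lam \<epsilon>)\<^sup>2 + of_real r * G (of_real \<epsilon> * lam \<epsilon>) = 0 \<and>
      \<bar>Re (lam \<epsilon>) / \<Lambda> - (1 - r * a * \<epsilon>\<^sup>2 / 2)\<bar> \<le> max C1 C2 * \<epsilon> ^ 4 \<and>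
      \<bar>\<epsilon> * Im (lam \<epsilon>) + \<kappa> / 2 * r ^ (l + 1) * n ^ l * \<epsilon> ^ (2 * l + 2)\<bar> \<le> max C1 C2 * \<epsilon> ^ (2 * l + 4)"
    unfolding eventually_at_right_field by blast
  show ?thesis
  \<comment> \<open>Halving \<open>b\<close> turns the strict upper bound on \<epsilon> into a
    non-strict one.\<close>
  proof (rule exI[of _ "b / 2"], intro conjI exI[of _ "max C1 C2"] allI impI)
    fix \<epsilon> :: real assume "0 < \<epsilon> \<and> \<epsilon> \<le> b / 2"
    then have "0 < \<epsilon>" "\<epsilon> < b" using \<open>b > 0\<close> by auto
    from b[OF this] show "\<exists>lam. norm (of_real \<epsilon> * lam) \<le> \<rho> \<and> Re lam > 0 \<and>
      lam\<^sup>2 + of_real r * G (of_real \<epsilon> * lam) = 0 \<and>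
      \<bar>Re lam / \<Lambda> - (1 - r * a * \<epsilon>\<^sup>2 / 2)\<bar> \<le> max C1 C2 * \<epsilon> ^ 4 \<and>
      \<bar>\<epsilon> * Im lam + \<kappa> / 2 * r ^ (l + 1) * n ^ l * \<epsilon> ^ (2 * l + 2)\<bar> \<le> max C1 C2 * \<epsilon> ^ (2 * l + 4)"
      by blast
  qed (use \<open>b > 0\<close> in simp)
qed

section \<open>Spherical harmonics\<close>

text \<open>With k = m, q the m-th derivative of the Legendre polynomial and c = a - m this is r^a
  Y_l^m up to normalization. A real exponent c lets divisions by r stay inside the class.\<close>

definition solid_term :: "nat \<Rightarrow> real \<Rightarrow> real poly \<Rightarrow> real^3 \<Rightarrow> complex" where
  "solid_term k c q y = (of_real (y $ 1) + \<i> * of_real (y $ 2)) ^ k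
      * of_real (norm y powr c * poly q (y $ 3 / norm y))"

lemma solid_term_add: "solid_term k c (p + q) y = solid_term k c p y + solid_term k c q y"
  by (simp add: solid_term_def algebra_simps)

lemma solid_term_smult: "solid_term k c (smult a q) y = of_real a * solid_term k c q y"
  by (simp add: solid_term_def)

lemma solid_term_mult_coord:
  assumes "y \<noteq> 0"
  shows "of_real (y $ 3) * solid_term k c q y = solid_term k (c + 1) ([:0, 1:] * q) y"
  using assms by (simp add: solid_term_def powr_add)

lemma solid_term_mult_norm2:
  assumes "y \<noteq> 0"
  shows "of_real ((norm y)\<^sup>2) * solid_term k c q y = solid_term k (c + 2) q y"
proof -
  have "norm y powr (c + 2) = (norm y)\<^sup>2 * norm y powr c"
    using assms by (simp add: powr_add)
  then show ?thesis by (simp add: solid_term_def mult_ac)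
qed

text \<open>Product rule with d(x3/r) = e3/r - x3 (y . e)/r^3; the two terms along y combine into
  the profile c q - t q'. For k = 0 the truncated index k - 1 is harmless because of the factor
  \<open>of_nat k\<close>.\<close>

lemma solid_term_has_vector_derivative:
  fixes y e :: "real^3"
  assumes "y \<noteq> 0"
  shows "((\<lambda>s. solid_term k c q (y + s *\<^sub>R e)) has_vector_derivative
     (of_nat k * (of_real (e $ 1) + \<i> * of_real (e $ 2)) * solid_term (k - 1) c q y
      + of_real (e $ 3) * solid_term k (c - 1) (pderiv q) y
      + of_real (y \<bullet> e) * solid_term k (c - 2) (smult c q - [:0, 1:] * pderiv q) y)) (at 0)"
proof -
  let ?r = "norm y" and ?t = "y $ 3 / norm y"
  have r: "?r > 0" using assms by simp
  have nd: "((\<lambda>s. norm (y + s *\<^sub>R e)) has_real_derivative (y \<bullet> e) / ?r) (at 0)"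
  proof -
    have "((\<lambda>s. (y + s *\<^sub>R e) \<bullet> (y + s *\<^sub>R e)) has_real_derivative 2 * (y \<bullet> e)) (at 0)"
      unfolding inner_add_left inner_add_right inner_scaleR_left inner_scaleR_right
      by (auto intro!: derivative_eq_intros simp: inner_commute)
    from DERIV_chain2[OF DERIV_real_sqrt this] have "((\<lambda>s. sqrt ((y + s *\<^sub>R e) \<bullet> (y + s *\<^sub>R e))) has_real_derivative inverse (sqrt (y \<bullet> y)) / 2 * (2 * (y \<bullet> e))) (at 0)"
      using assms by simp
    then have "((\<lambda>s. norm (y + s *\<^sub>R e)) has_real_derivative inverse ?r / 2 * (2 * (y \<bullet> e))) (at 0)"
      by (simp only: norm_eq_sqrt_inner[of y] norm_eq_sqrt_inner[of "y + _"])
    moreover have "inverse ?r / 2 * (2 * (y \<bullet> e)) = (y \<bullet> e) / ?r" by (simp add: field_simps)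
    ultimately show ?thesis by metis
  qed
  have td: "((\<lambda>s. (y + s *\<^sub>R e) $ 3 / norm (y + s *\<^sub>R e)) has_real_derivative
      (e $ 3 * ?r - y $ 3 * ((y \<bullet> e) / ?r)) / (?r * ?r)) (at 0)"
    using nd r by (auto intro!: derivative_eq_intros)
  have pd: "((\<lambda>s. norm (y + s *\<^sub>R e) powr c) has_real_derivative c * ?r powr (c - 1) * ((y \<bullet> e) / ?r)) (at 0)"
    using DERIV_fun_powr[OF nd, of c] r by simp
  have qd: "((\<lambda>s. poly q ((y + s *\<^sub>R e) $ 3 / norm (y + s *\<^sub>R e))) has_real_derivative
      poly (pderiv q) ?t * ((e $ 3 * ?r - y $ 3 * ((y \<bullet> e) / ?r)) / (?r * ?r))) (at 0)"
    using DERIV_chain2[OF poly_DERIV td, of q] by simp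
  define D where "D = c * ?r powr (c - 1) * ((y \<bullet> e) / ?r) * poly q ?t
      + poly (pderiv q) ?t * ((e $ 3 * ?r - y $ 3 * ((y \<bullet> e) / ?r)) / (?r * ?r)) * ?r powr c"
  have prod: "((\<lambda>s. norm (y + s *\<^sub>R e) powr c * poly q ((y + s *\<^sub>R e) $ 3 / norm (y + s *\<^sub>R e))) has_real_derivative D) (at 0)"
    using DERIV_mult[OF pd qd] by (simp add: D_def)
  let ?z = "\<lambda>s. complex_of_real ((y + s *\<^sub>R e) $ 1) + \<i> * of_real ((y + s *\<^sub>R e) $ 2)"
  let ?a = "complex_of_real (e $ 1) + \<i> * of_real (e $ 2)"
  have z1: "(?z has_vector_derivative ?a) (at 0)"
    by (auto intro!: derivative_eq_intros has_vector_derivative_of_real)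
  have zk: "((\<lambda>s. ?z s ^ k) has_vector_derivative of_nat k * ?a * ?z 0 ^ (k - 1)) (at 0)"
  proof -
    have "((\<lambda>z. z ^ k) has_field_derivative of_nat k * ?z 0 ^ (k - 1)) (at (?z 0))"
      by (rule derivative_eq_intros refl)+ simp
    from field_vector_diff_chain_at[OF z1 this] show ?thesis
      by (simp only: o_def mult_ac)
  qed
  have D: "D = e $ 3 * (?r powr (c - 1) * poly (pderiv q) ?t)
      + (y \<bullet> e) * (?r powr (c - 2) * poly (smult c q - [:0, 1:] * pderiv q) ?t)"
  proof -
    have e: "?r powr (c - 1) = ?r powr c / ?r" "?r powr (c - 2) = ?r powr c / (?r * ?r)"
      using r by (simp_all add: powr_diff power2_eq_square)
    show ?thesis using r unfolding D_def e by (simp add: field_simps)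
  qed
  have "((\<lambda>s. solid_term k c q (y + s *\<^sub>R e)) has_vector_derivative
      ?z 0 ^ k * of_real D + of_nat k * ?a * ?z 0 ^ (k - 1) * of_real (?r powr c * poly q ?t)) (at 0)"
    unfolding solid_term_def
    using has_vector_derivative_mult[OF zk has_vector_derivative_of_real[OF prod]] by simp
  moreover have "?z 0 ^ k * of_real D + of_nat k * ?a * ?z 0 ^ (k - 1) * of_real (?r powr c * poly q ?t)
     = of_nat k * ?a * solid_term (k - 1) c q y
      + of_real (e $ 3) * solid_term k (c - 1) (pderiv q) y
      + of_real (y \<bullet> e) * solid_term k (c - 2) (smult c q - [:0, 1:] * pderiv q) y"
    unfolding D solid_term_def by (simp add: algebra_simps)
  ultimately show ?thesis by simp
qed

lemma has_laplacianI:
  assumes "open U" "x \<in> U"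
    and "\<And>i y. y \<in> U \<Longrightarrow> ((\<lambda>s. f (y + s *\<^sub>R axis i 1)) has_vector_derivative g i y) (at 0)"
    and "\<And>i. ((\<lambda>s. g i (x + s *\<^sub>R axis i 1)) has_vector_derivative d i) (at 0)"
    and "L = (\<Sum>i\<in>UNIV. d i)"
  shows "has_laplacian f L x"
  unfolding has_laplacian_def using assms by blast

lemma has_laplacian_cmult:
  assumes "has_laplacian f L x"
  shows "has_laplacian (\<lambda>y. a * f y) (a * L) x"
proof -
  obtain g U d where "open U" "x \<in> U"
    and *: "\<And>i y. y \<in> U \<Longrightarrow> ((\<lambda>s. f (y + s *\<^sub>R axis i 1)) has_vector_derivative g i y) (at 0)"
      "\<And>i. ((\<lambda>s. g i (x + s *\<^sub>R axis i 1)) has_vector_derivative d i) (at 0)"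
    and "L = (\<Sum>i\<in>UNIV. d i)"
    using assms unfolding has_laplacian_def by blast
  then show ?thesis
    by (intro has_laplacianI[of U x _ "\<lambda>i y. a * g i y" "\<lambda>i. a * d i"] has_vector_derivative_mult_right *)
      (auto simp: sum_distrib_left)
qed

lemma has_laplacian_cnj:
  assumes "has_laplacian f L x"
  shows "has_laplacian (\<lambda>y. cnj (f y)) (cnj L) x"
proof -
  obtain g U d where "open U" "x \<in> U"
    and *: "\<And>i y. y \<in> U \<Longrightarrow> ((\<lambda>s. f (y + s *\<^sub>R axis i 1)) has_vector_derivative g i y) (at 0)"
      "\<And>i. ((\<lambda>s. g i (x + s *\<^sub>R axis i 1)) has_vector_derivative d i) (at 0)"
    and "L = (\<Sum>i\<in>UNIV. d i)"
    using assms unfolding has_laplacian_def by blast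
  then show ?thesis
    by (intro has_laplacianI[of U x _ "\<lambda>i y. cnj (g i y)" "\<lambda>i. cnj (d i)"] has_vector_derivative_cnj *)
      (auto simp: cnj_sum)
qed

lemma has_laplacian_cong:
  assumes "has_laplacian f L x" "open V" "x \<in> V" "\<And>y. y \<in> V \<Longrightarrow> f y = h y"
  shows "has_laplacian h L x"
proof -
  obtain g U d where U: "open U" "x \<in> U"
    and *: "\<And>i y. y \<in> U \<Longrightarrow> ((\<lambda>s. f (y + s *\<^sub>R axis i 1)) has_vector_derivative g i y) (at 0)"
      "\<And>i. ((\<lambda>s. g i (x + s *\<^sub>R axis i 1)) has_vector_derivative d i) (at 0)"
    and L: "L = (\<Sum>i\<in>UNIV. d i)"
    using assms unfolding has_laplacian_def by blast
  show ?thesis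
  proof (rule has_laplacianI[of "U \<inter> V" x h g d])
    fix i :: 3 and y assume y: "y \<in> U \<inter> V"
    have V: "open ((\<lambda>s::real. y + s *\<^sub>R axis i 1) -` V)"
      by (intro open_vimage assms(2) continuous_intros)
    show "((\<lambda>s. h (y + s *\<^sub>R axis i 1)) has_vector_derivative g i y) (at 0)"
      by (rule has_vector_derivative_transform_within_open[OF *(1) V])
        (use y assms(4) in auto)
  qed (use U * L assms in auto)
qed

text \<open>(x1 + i x2)^k is harmonic and homogeneous of degree k and does not depend on x3. Hence
  it contributes only through its radial derivative, which is the source of the shifts by 2k in the
  coefficients.\<close>

lemma solid_term_has_laplacian:
  fixes k :: nat and c :: real and q :: "real poly" and x :: "real^3"
  assumes "x \<noteq> 0"
  shows "has_laplacian (solid_term k c q)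
     (solid_term k (c - 2) ([:1, 0, -1:] * pderiv (pderiv q)
        - smult (2 * (real k + 1)) ([:0, 1:] * pderiv q)
        + smult (c * (c + 2 * real k + 1)) q) x) x"
proof -
  let ?S = solid_term and ?X = "[:0, 1:] :: real poly"
  define p where "p = smult c q - ?X * pderiv q"
  define z where "z i = complex_of_real (axis i 1 $ 1) + \<i> * of_real (axis i 1 $ 2)" for i :: 3
  define w where "w i = complex_of_real (axis i 1 $ 3)" for i :: 3
  define g where "g i y = of_nat k * z i * ?S (k - 1) c q y + w i * ?S k (c - 1) (pderiv q) y
      + of_real (y \<bullet> axis i 1) * ?S k (c - 2) p y" for i y
  \<comment> \<open>The derivative rule applied to each summand of \<open>g\<close>; the final
    \<open>?S k (c - 2) p x\<close> comes from differentiating the coordinate factor.\<close>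
  define d where "d i =
      of_nat k * z i * (of_nat (k - 1) * z i * ?S (k - 1 - 1) c q x + w i * ?S (k - 1) (c - 1) (pderiv q) x
          + of_real (x \<bullet> axis i 1) * ?S (k - 1) (c - 2) p x)
      + w i * (of_nat k * z i * ?S (k - 1) (c - 1) (pderiv q) x + w i * ?S k (c - 2) (pderiv (pderiv q)) x
          + of_real (x \<bullet> axis i 1) * ?S k (c - 3) (smult (c - 1) (pderiv q) - ?X * pderiv (pderiv q)) x)
      + (of_real (x \<bullet> axis i 1) * (of_nat k * z i * ?S (k - 1) (c - 2) p x + w i * ?S k (c - 3) (pderiv p) x
          + of_real (x \<bullet> axis i 1) * ?S k (c - 4) (smult (c - 2) p - ?X * pderiv p) x)
         + ?S k (c - 2) p x)" for i
  have der: "((\<lambda>s. ?S k c q (y + s *\<^sub>R axis i 1)) has_vector_derivative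
      of_nat k * z i * ?S (k - 1) c q y + w i * ?S k (c - 1) (pderiv q) y
      + of_real (y \<bullet> axis i 1) * ?S k (c - 2) (smult c q - ?X * pderiv q) y) (at 0)"
    if "y \<noteq> 0" for k c q y i
    using solid_term_has_vector_derivative[OF that, of k c q "axis i 1"] by (simp only: z_def w_def)
  show ?thesis
  proof (rule has_laplacianI[of "- {0}" x _ g d])
    fix i :: 3 and y :: "real^3" assume "y \<in> - {0}"
    then show "((\<lambda>s. ?S k c q (y + s *\<^sub>R axis i 1)) has_vector_derivative g i y) (at 0)"
      using der[of y k c q i] by (simp add: g_def p_def)
  next
    fix i :: 3
    have "((\<lambda>s. complex_of_real ((x + s *\<^sub>R axis i 1) \<bullet> axis i 1)) has_vector_derivative of_real 1) (at 0)"
      unfolding inner_add_left inner_scaleR_left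
      by (intro has_vector_derivative_of_real) (auto intro!: derivative_eq_intros simp: inner_axis_axis)
    note t3 = has_vector_derivative_mult[OF this der[OF assms, of k "c - 2" p i],
        unfolded scaleR_zero_left add_0_right of_real_1 mult_1_left]
    note t1 = has_vector_derivative_mult_right[OF der[OF assms, of "k - 1" c q i], of "of_nat k * z i"]
    note t2 = has_vector_derivative_mult_right[OF der[OF assms, of k "c - 1" "pderiv q" i], of "w i"]
    have "c - 1 - 1 = c - 2" "c - 1 - 2 = c - 3" "c - 2 - 1 = c - 3" "c - 2 - 2 = c - 4" by simp_all
    then show "((\<lambda>s. g i (x + s *\<^sub>R axis i 1)) has_vector_derivative d i) (at 0)"
      using has_vector_derivative_add[OF has_vector_derivative_add[OF t1 t2] t3]
      by (simp only: g_def d_def p_def[symmetric])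
  next
    have comp: "solid_term k (c - 2) ([:1, 0, -1:] * pderiv (pderiv q)
        - smult (2 * (real k + 1)) (?X * pderiv q) + smult (c * (c + 2 * real k + 1)) q) x
      = (\<Sum>i\<in>UNIV. d i)"
    proof -
      let ?A = "of_nat k * (of_real (x $ 1) + \<i> * of_real (x $ 2)) * ?S (k - 1) (c - 2) p x"
      have A: "?A = of_nat k * ?S k (c - 2) p x"
        by (cases k) (simp_all add: solid_term_def)
      have N: "complex_of_real ((norm x)\<^sup>2) = of_real (x $ 1) ^ 2 + of_real (x $ 2) ^ 2 + of_real (x $ 3) ^ 2"
        unfolding power2_norm_eq_inner by (simp add: inner_vec_def sum_3 power2_eq_square)
      have zw: "z 1 = 1" "z 2 = \<i>" "z 3 = 0" "w 1 = 0" "w 2 = 0" "w 3 = 1"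
        by (simp_all add: z_def w_def axis_def)
      have ia: "x \<bullet> axis i 1 = x $ i" for i by (simp add: inner_axis)
      \<comment> \<open>With z = (1, i, 0) and w = (0, 0, 1): the squares of z sum to 1 + i^2 = 0,
        which removes S1, z . w = 0 removes S2, and x . z = x1 + i x2 stays beside S3. The atoms
        stand for the \<open>solid_term\<close> values, so this is pure ring algebra.\<close>
      have gen: "(K * 1 * (K1 * 1 * S1 + 0 * S2 + x1 * S3) + 0 * (K * 1 * S2 + 0 * S4 + x1 * S5)
          + (x1 * (K * 1 * S3 + 0 * S6 + x1 * S7) + S8))
        + (K * \<i> * (K1 * \<i> * S1 + 0 * S2 + x2 * S3) + 0 * (K * \<i> * S2 + 0 * S4 + x2 * S5)
          + (x2 * (K * \<i> * S3 + 0 * S6 + x2 * S7) + S8))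
        + (K * 0 * (K1 * 0 * S1 + 1 * S2 + x3 * S3) + 1 * (K * 0 * S2 + 1 * S4 + x3 * S5)
          + (x3 * (K * 0 * S3 + 1 * S6 + x3 * S7) + S8))
        = 2 * (K * (x1 + \<i> * x2) * S3) + S4 + x3 * S5 + x3 * S6 + 3 * S8 + (x1\<^sup>2 + x2\<^sup>2 + x3\<^sup>2) * S7"
        for K K1 S1 S2 S3 S4 S5 S6 S7 S8 x1 x2 x3 :: complex
        by (simp add: algebra_simps power2_eq_square)
      have "(\<Sum>i\<in>UNIV. d i) = 2 * ?A + ?S k (c - 2) (pderiv (pderiv q)) x
         + of_real (x $ 3) * ?S k (c - 3) (smult (c - 1) (pderiv q) - ?X * pderiv (pderiv q)) x
         + of_real (x $ 3) * ?S k (c - 3) (pderiv p) x + 3 * ?S k (c - 2) p x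
         + of_real ((norm x)\<^sup>2) * ?S k (c - 4) (smult (c - 2) p - ?X * pderiv p) x"
        unfolding sum_3 d_def zw N ia
        by (rule gen)
      \<comment> \<open>The factors x3 and |x|^2 raise the exponents c - 3 and c - 4 to the common
        value c - 2, so all profiles can be added.\<close>
      also have "\<dots> = ?S k (c - 2) (smult (2 * real k) p + pderiv (pderiv q)
          + ?X * (smult (c - 1) (pderiv q) - ?X * pderiv (pderiv q)) + ?X * pderiv p + smult 3 p
          + (smult (c - 2) p - ?X * pderiv p)) x"
        unfolding A solid_term_mult_coord[OF assms] solid_term_mult_norm2[OF assms]
        by (simp only: solid_term_add solid_term_smult) simp
      also have "smult (2 * real k) p + pderiv (pderiv q)
          + ?X * (smult (c - 1) (pderiv q) - ?X * pderiv (pderiv q)) + ?X * pderiv p + smult 3 p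
          + (smult (c - 2) p - ?X * pderiv p)
          = [:1, 0, -1:] * pderiv (pderiv q)
        - smult (2 * (real k + 1)) (?X * pderiv q) + smult (c * (c + 2 * real k + 1)) q"
        unfolding p_def by (rule poly_ext) (simp add: algebra_simps)
      finally show ?thesis by simp
    qed
    show "solid_term k (c - 2) ([:1, 0, -1:] * pderiv (pderiv q)
        - smult (2 * (real k + 1)) (?X * pderiv q) + smult (c * (c + 2 * real k + 1)) q) x
      = (\<Sum>i\<in>UNIV. d i)" by (rule comp)
  qed (use assms in auto)
qed

section \<open>Legendre equations and spherical eigenfunctions\<close>

text \<open>The first-order identity (x^2 - 1) u' = 2l x u, differentiated n + 1 times. Each
  induction step is one more differentiation.\<close>

lemma rodrigues_ode:
  fixes l n :: nat
  defines "u \<equiv> [:-1, 0, 1:] ^ l :: real poly"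
  shows "[:-1, 0, 1:] * (pderiv ^^ (n + 2)) u
     + smult (2 * real n + 2 - 2 * real l) ([:0, 1:] * (pderiv ^^ (n + 1)) u)
     + smult ((real n + 1) * (real n - 2 * real l)) ((pderiv ^^ n) u) = 0"
proof -
  have dw: "pderiv ([:-1, 0, 1:] * p) = [:-1, 0, 1:] * pderiv p + smult 2 ([:0, 1:] * p)"
    and dX: "pderiv ([:0, 1:] * p) = [:0, 1:] * pderiv p + p" for p :: "real poly"
    by (simp_all only: pderiv_mult) (simp_all add: pderiv_pCons)
  show ?thesis
  proof (induction n)
    case 0
    let ?w = "[:-1, 0, 1:] :: real poly" and ?X = "[:0, 1:] :: real poly"
    have e: "?w * pderiv u = smult (2 * real l) (?X * u)"
    proof (cases l)
      case 0
      then show ?thesis by (simp add: u_def)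
    next
      case (Suc k)
      have "pderiv ?w = smult 2 ?X" by (simp add: pderiv_pCons)
      then show ?thesis
        unfolding u_def Suc pderiv_power_Suc by (simp add: algebra_simps)
    qed
    have "pderiv (?w * pderiv u) = pderiv (smult (2 * real l) (?X * u))" by (simp only: e)
    then have "?w * pderiv (pderiv u) + smult 2 (?X * pderiv u) = smult (2 * real l) (u + ?X * pderiv u)"
      unfolding pderiv_smult dw dX by (simp only: add.commute)
    then have "poly (?w * pderiv (pderiv u) + smult 2 (?X * pderiv u)) x = poly (smult (2 * real l) (u + ?X * pderiv u)) x" for x
      by simp
    then show ?case
      by (intro poly_ext) (simp add: eval_nat_numeral algebra_simps)
  next
    case (Suc n)
    let ?w = "[:-1, 0, 1:] :: real poly" and ?X = "[:0, 1:] :: real poly"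
    let ?D = "\<lambda>n. (pderiv ^^ n) u"
    have "pderiv (?w * ?D (n + 2) + smult (2 * real n + 2 - 2 * real l) (?X * ?D (n + 1))
       + smult ((real n + 1) * (real n - 2 * real l)) (?D n)) = 0"
      unfolding Suc.IH by simp
    then have "?w * ?D (n + 3) + smult 2 (?X * ?D (n + 2))
       + smult (2 * real n + 2 - 2 * real l) (?D (n + 1) + ?X * ?D (n + 2))
       + smult ((real n + 1) * (real n - 2 * real l)) (?D (n + 1)) = 0"
      unfolding pderiv_add pderiv_smult dw dX pderiv_0 by (simp add: eval_nat_numeral algebra_simps)
    then have "poly (?w * ?D (n + 3) + smult 2 (?X * ?D (n + 2))
       + smult (2 * real n + 2 - 2 * real l) (?D (n + 1) + ?X * ?D (n + 2))
       + smult ((real n + 1) * (real n - 2 * real l)) (?D (n + 1))) x = 0" for x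
      by (simp only: poly_0)
    then show ?case
      by (intro poly_ext) (simp add: eval_nat_numeral algebra_simps)
  qed
qed

text \<open>By Rodrigues' formula q is a multiple of the (l+m)-th derivative of u, so the previous
  identity applies with n = l + m, where (l+m+1)(m-l) = m(m+1) - l(l+1). Passing from x^2 - 1 to 1 -
  x^2 changes the signs.\<close>

lemma legendre_ode:
  fixes l m :: nat
  defines "q \<equiv> (pderiv ^^ m) (legendre_poly l)"
  shows "[:1, 0, -1:] * pderiv (pderiv q) - smult (2 * (real m + 1)) ([:0, 1:] * pderiv q)
     = smult (real m * (real m + 1) - real l * (real l + 1)) q"
proof (rule poly_ext)
  fix x :: real
  define u where "u = ([:-1, 0, 1:] :: real poly) ^ l"
  define a :: real where "a = 1 / (2 ^ l * fact l)"
  have q: "(pderiv ^^ j) q = smult a ((pderiv ^^ (l + m + j)) u)" for j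
    unfolding q_def legendre_poly_def u_def a_def
    by (simp add: higher_pderiv_smult flip: funpow_add[THEN fun_cong, unfolded o_def]) (simp add: add_ac)
  have q0: "q = smult a ((pderiv ^^ (l + m)) u)" "pderiv q = smult a ((pderiv ^^ (l + m + 1)) u)"
    "pderiv (pderiv q) = smult a ((pderiv ^^ (l + m + 2)) u)"
    using q[of 0] q[of 1] q[of 2] by (simp_all add: eval_nat_numeral)
  have "poly ([:-1, 0, 1:] * (pderiv ^^ (l + m + 2)) u
     + smult (2 * real (l + m) + 2 - 2 * real l) ([:0, 1:] * (pderiv ^^ (l + m + 1)) u)
     + smult ((real (l + m) + 1) * (real (l + m) - 2 * real l)) ((pderiv ^^ (l + m)) u)) x = poly 0 x"
    unfolding u_def rodrigues_ode by (rule refl)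
  then have "(x * x - 1) * poly ((pderiv ^^ (l + m + 2)) u) x
     + (2 * real m + 2) * (x * poly ((pderiv ^^ (l + m + 1)) u) x)
     + (real l + real m + 1) * (real m - real l) * poly ((pderiv ^^ (l + m)) u) x = 0"
    by (simp add: algebra_simps)
  then have "a * ((x * x - 1) * poly ((pderiv ^^ (l + m + 2)) u) x
     + (2 * real m + 2) * (x * poly ((pderiv ^^ (l + m + 1)) u) x)
     + (real l + real m + 1) * (real m - real l) * poly ((pderiv ^^ (l + m)) u) x) = a * 0"
    by (simp only:)
  then show "poly ([:1, 0, -1:] * pderiv (pderiv q) - smult (2 * (real m + 1)) ([:0, 1:] * pderiv q)) x
     = poly (smult (real m * (real m + 1) - real l * (real l + 1)) q) x"
    unfolding q0(3) unfolding q0(2) unfolding q0(1) by (simp add: algebra_simps)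
qed

lemma sph_harm_nonneg_homogeneous:
  fixes y :: "real^3"
  assumes "y \<noteq> 0"
  shows "sph_harm_nonneg l m (y /\<^sub>R norm y) * of_real (norm y powr a) =
    of_real (sqrt ((2 * real l + 1) / (4 * pi) * (fact (l - m) / fact (l + m)))) * (-1) ^ m
      * solid_term m (a - real m) ((pderiv ^^ m) (legendre_poly l)) y"
proof -
  have "of_real ((y /\<^sub>R norm y) $ 1) + \<i> * of_real ((y /\<^sub>R norm y) $ 2)
      = (of_real (y $ 1) + \<i> * of_real (y $ 2)) / complex_of_real (norm y)"
    using assms by (simp add: field_simps)
  moreover have "norm y powr (a - real m) = norm y powr a / norm y ^ m"
    using assms by (simp add: powr_diff powr_realpow)
  moreover have "(y /\<^sub>R norm y) $ 3 = y $ 3 / norm y"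
    by (simp add: field_simps)
  ultimately show ?thesis
    unfolding sph_harm_nonneg_def solid_term_def by (simp add: power_divide)
qed

text \<open>With c = a - m one has c(c + 2m + 1) = a(a+1) - m(m+1), so the m-dependent part cancels
  against \<open>legendre_ode\<close>. Negative orders follow by conjugation, since the eigenvalue
  factor is real.\<close>

lemma sph_harm_has_laplacian:
  fixes x :: "real^3" and a :: real
  assumes "x \<noteq> 0"
  shows "has_laplacian (\<lambda>y. sph_harm l m (y /\<^sub>R norm y) * of_real (norm y powr a))
     (of_real (a * (a + 1) - real l * (real l + 1))
        * (sph_harm l m (x /\<^sub>R norm x) * of_real (norm x powr (a - 2)))) x"
proof -
  have nn: "has_laplacian (\<lambda>y. sph_harm_nonneg l m (y /\<^sub>R norm y) * of_real (norm y powr a))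
     (of_real (a * (a + 1) - real l * (real l + 1))
        * (sph_harm_nonneg l m (x /\<^sub>R norm x) * of_real (norm x powr (a - 2)))) x" for m
  proof -
    let ?N = "of_real (sqrt ((2 * real l + 1) / (4 * pi) * (fact (l - m) / fact (l + m)))) * (-1) ^ m :: complex"
    define q where "q = (pderiv ^^ m) (legendre_poly l)"
    define c where "c = a - real m"
    have "[:1, 0, -1:] * pderiv (pderiv q) - smult (2 * (real m + 1)) ([:0, 1:] * pderiv q)
        + smult (c * (c + 2 * real m + 1)) q = smult (a * (a + 1) - real l * (real l + 1)) q"
      unfolding q_def legendre_ode c_def smult_add_left[symmetric] by (simp add: algebra_simps)
    with has_laplacian_cmult[OF solid_term_has_laplacian[OF assms, of m c q], of ?N]
    have "has_laplacian (\<lambda>y. ?N * solid_term m c q y)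
        (?N * (of_real (a * (a + 1) - real l * (real l + 1)) * solid_term m (c - 2) q x)) x"
      by (simp only: solid_term_smult)
    also have "?N * (of_real (a * (a + 1) - real l * (real l + 1)) * solid_term m (c - 2) q x)
        = of_real (a * (a + 1) - real l * (real l + 1)) * (?N * solid_term m (a - 2 - real m) q x)"
    proof -
      have "c - 2 = a - 2 - real m" by (simp add: c_def)
      then show ?thesis by (simp only: mult_ac)
    qed
    also have "?N * solid_term m (a - 2 - real m) q x
        = sph_harm_nonneg l m (x /\<^sub>R norm x) * of_real (norm x powr (a - 2))"
      unfolding q_def by (rule sph_harm_nonneg_homogeneous[OF assms, symmetric])
    finally show ?thesis
      by (rule has_laplacian_cong[of _ _ _ "- {0}"])
        (use assms in \<open>auto simp: c_def q_def sph_harm_nonneg_homogeneous\<close>)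
  qed
  show ?thesis
  proof (cases "0 \<le> m")
    case True
    then show ?thesis using nn[of "nat m"] by (simp add: sph_harm_def)
  next
    case False
    then show ?thesis
      using has_laplacian_cmult[OF has_laplacian_cnj[OF nn[of "nat (- m)"]], of "(-1) ^ nat (- m)"]
      by (simp add: sph_harm_def mult_ac)
  qed
qed

section \<open>Projection onto the constant mode\<close>

lemma sph_harm_sph_pt:
  obtains K where "\<And>\<theta> \<phi>. sph_harm l m (sph_pt \<theta> \<phi>)
    = K * cis (of_int m * \<phi>) * of_real (sin \<theta> ^ nat \<bar>m\<bar> * poly ((pderiv ^^ nat \<bar>m\<bar>) (legendre_poly l)) (cos \<theta>))"
proof -
  let ?N = "\<lambda>k. of_real (sqrt ((2 * real l + 1) / (4 * pi) * (fact (l - k) / fact (l + k)))) * (-1) ^ k :: complex"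
  have nn: "sph_harm_nonneg l k (sph_pt \<theta> \<phi>)
    = ?N k * cis (real k * \<phi>) * of_real (sin \<theta> ^ k * poly ((pderiv ^^ k) (legendre_poly l)) (cos \<theta>))" for k \<theta> \<phi>
  proof -
    have "of_real (sph_pt \<theta> \<phi> $ 1) + \<i> * of_real (sph_pt \<theta> \<phi> $ 2) = of_real (sin \<theta>) * cis \<phi>"
      by (simp add: sph_pt_def complex_eq_iff)
    moreover have "sph_pt \<theta> \<phi> $ 3 = cos \<theta>" by (simp add: sph_pt_def)
    ultimately show ?thesis
      unfolding sph_harm_nonneg_def by (simp only: power_mult_distrib Complex.DeMoivre) simp
  qed
  show ?thesis
  proof (cases "0 \<le> m")
    case True
    then show ?thesis
      by (intro that[of "?N (nat m)"]) (simp add: sph_harm_def nn)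
  next
    case False
    then have "cnj (cis (real (nat (- m)) * \<phi>)) = cis (of_int m * \<phi>)" for \<phi>
      by (simp add: cis_cnj)
    then show ?thesis using False
      by (intro that[of "(-1) ^ nat (- m) * ?N (nat (- m))"]) (simp add: sph_harm_def nn)
  qed
qed

lemma integral_cis:
  assumes "m \<noteq> 0"
  shows "integral {0..2 * pi} (\<lambda>\<phi>. cis (of_int m * \<phi>)) = 0"
proof -
  have "((\<lambda>\<phi>. cis (of_int m * \<phi>)) has_integral
      (cis (of_int m * (2 * pi)) / (\<i> * of_int m) - cis (of_int m * 0) / (\<i> * of_int m))) {0..2 * pi}"
  proof (rule fundamental_theorem_of_calculus)
    fix \<phi> :: real
    have "((\<lambda>z. exp (\<i> * (of_int m * z)) / (\<i> * of_int m)) has_field_derivative exp (\<i> * (of_int m * of_real \<phi>))) (at (of_real \<phi>))"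
    proof -
      have "((\<lambda>z. exp (w * z) / w) has_field_derivative exp (w * z)) (at z)" if "w \<noteq> 0" for w z :: complex
        using that by (auto intro!: derivative_eq_intros)
      from this[of "\<i> * of_int m"] show ?thesis using assms by (simp add: mult.assoc)
    qed
    then have "((\<lambda>\<phi>. exp (\<i> * (of_int m * of_real \<phi>)) / (\<i> * of_int m)) has_vector_derivative exp (\<i> * (of_int m * of_real \<phi>))) (at \<phi>)"
      by (rule has_vector_derivative_real_field)
    from has_vector_derivative_at_within[OF this] show "((\<lambda>\<phi>. cis (of_int m * \<phi>) / (\<i> * of_int m)) has_vector_derivative cis (of_int m * \<phi>)) (at \<phi> within {0..2 * pi})"
      by (simp only: cis_conv_exp of_real_mult of_real_of_int_eq)
  qed simp
  moreover have "cis (of_int m * (2 * pi)) = 1"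
    using cis_multiple_2pi[of "of_int m"] by (simp add: mult_ac)
  ultimately show ?thesis by (simp add: integral_unique)
qed

text \<open>In the form ((1 - t^2) P')' = -l(l+1) P the Legendre equation supplies an
  antiderivative, whose factor \<open>sin \<theta>\<close> squared vanishes at both poles.\<close>

lemma integral_legendre:
  assumes "l \<noteq> 0"
  shows "integral {0..pi} (\<lambda>\<theta>. poly (legendre_poly l) (cos \<theta>) * sin \<theta>) = 0"
proof -
  let ?P = "poly (legendre_poly l)" and ?P' = "poly (pderiv (legendre_poly l))"
    and ?P2 = "poly (pderiv (pderiv (legendre_poly l)))"
  let ?c = "real l * (real l + 1)"
  have c: "?c \<noteq> 0" using assms by simp
  have "((\<lambda>\<theta>. ?P (cos \<theta>) * sin \<theta>) has_integral
      ((sin pi)\<^sup>2 * ?P' (cos pi) / ?c - (sin 0)\<^sup>2 * ?P' (cos 0) / ?c)) {0..pi}"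
  proof (rule fundamental_theorem_of_calculus)
    fix \<theta> :: real
    have "poly ([:1, 0, -1:] * pderiv (pderiv (legendre_poly l)) - smult 2 ([:0, 1:] * pderiv (legendre_poly l))) (cos \<theta>)
        = poly (smult (- ?c) (legendre_poly l)) (cos \<theta>)"
      using legendre_ode[of 0 l] by simp
    then have "(1 - cos \<theta> * cos \<theta>) * ?P2 (cos \<theta>) - 2 * (cos \<theta> * ?P' (cos \<theta>)) = - ?c * ?P (cos \<theta>)"
      by (simp add: algebra_simps)
    moreover have "1 - cos \<theta> * cos \<theta> = (sin \<theta>)\<^sup>2"
      unfolding sin_squared_eq by (simp add: power2_eq_square)
    ultimately have ode: "2 * (cos \<theta> * ?P' (cos \<theta>)) - (sin \<theta>)\<^sup>2 * ?P2 (cos \<theta>) = ?c * ?P (cos \<theta>)"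
      by simp
    have "((\<lambda>\<theta>. (sin \<theta>)\<^sup>2 * ?P' (cos \<theta>)) has_real_derivative
        (2 * (cos \<theta> * ?P' (cos \<theta>)) - (sin \<theta>)\<^sup>2 * ?P2 (cos \<theta>)) * sin \<theta>) (at \<theta>)"
      by (auto intro!: derivative_eq_intros DERIV_chain2[OF poly_DERIV] simp: algebra_simps power2_eq_square)
    from DERIV_cdivide[OF this, of ?c]
    have "((\<lambda>\<theta>. (sin \<theta>)\<^sup>2 * ?P' (cos \<theta>) / ?c) has_real_derivative ?P (cos \<theta>) * sin \<theta>) (at \<theta>)"
      unfolding ode using c by simp
    then show "((\<lambda>\<theta>. (sin \<theta>)\<^sup>2 * ?P' (cos \<theta>) / ?c) has_vector_derivative ?P (cos \<theta>) * sin \<theta>) (at \<theta> within {0..pi})"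
      using has_real_derivative_iff_has_vector_derivative has_vector_derivative_at_within by blast
  qed simp
  then show ?thesis by (simp add: integral_unique)
qed

lemma sph_harm_0_0: "sph_harm 0 0 x = of_real (sqrt (1 / (4 * pi)))"
  by (simp add: sph_harm_def sph_harm_nonneg_def legendre_poly_def)

text \<open>Y_0^0 is constant, so this is the mean of Y_l^m up to a factor: the longitude integral
  kills nonzero m, the latitude integral kills m = 0 with l > 0. For l = 0 the normalization gives
  (1/(4 pi)) * 2 * (2 pi) = 1.\<close>

lemma sphere_inner_sph_harm_0:
  assumes "- int l \<le> m" "m \<le> int l"
  shows "sphere_inner (\<lambda>\<omega>. c * sph_harm l m \<omega>) (sph_harm 0 0) = (if l = 0 then c else 0)"
proof -
  let ?k = "nat \<bar>m\<bar>"
  obtain K where K: "\<And>\<theta> \<phi>. sph_harm l m (sph_pt \<theta> \<phi>)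
    = K * cis (of_int m * \<phi>) * of_real (sin \<theta> ^ ?k * poly ((pderiv ^^ ?k) (legendre_poly l)) (cos \<theta>))"
    using sph_harm_sph_pt[of l m] by blast
  define g where "g \<theta> = sin \<theta> ^ ?k * poly ((pderiv ^^ ?k) (legendre_poly l)) (cos \<theta>) * sin \<theta>" for \<theta>
  define C where "C = c * K * of_real (sqrt (1 / (4 * pi)))"
  let ?f = "\<lambda>(\<theta>, \<phi>). C * (of_real (g \<theta>) * cis (of_int m * \<phi>))"
  have "sphere_inner (\<lambda>\<omega>. c * sph_harm l m \<omega>) (sph_harm 0 0) = integral (cbox (0, 0) (pi, 2 * pi)) ?f"
    unfolding sphere_inner_def sph_harm_0_0 K g_def C_def
    by (intro arg_cong[where f = "integral _"] ext) (auto simp: mult_ac)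
  also have "\<dots> = integral (cbox 0 pi) (\<lambda>\<theta>. integral (cbox 0 (2 * pi)) (\<lambda>\<phi>. ?f (\<theta>, \<phi>)))"
    by (rule integral_prod_continuous) (auto simp: g_def case_prod_unfold intro!: continuous_intros)
  also have "\<dots> = C * (of_real (integral {0..pi} g) * integral {0..2 * pi} (\<lambda>\<phi>. cis (of_int m * \<phi>)))"
  proof -
    have "continuous_on {0..pi} g" unfolding g_def by (intro continuous_intros)
    then have "integral {0..pi} (\<lambda>\<theta>. complex_of_real (g \<theta>)) = of_real (integral {0..pi} g)"
      by (intro integral_unique has_integral_of_real integrable_integral integrable_continuous_interval)
    then show ?thesis by simp
  qed
  finally have eq: "sphere_inner (\<lambda>\<omega>. c * sph_harm l m \<omega>) (sph_harm 0 0)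
      = C * (of_real (integral {0..pi} g) * integral {0..2 * pi} (\<lambda>\<phi>. cis (of_int m * \<phi>)))" .
  show ?thesis
  proof (cases "m = 0")
    case False
    then show ?thesis using assms unfolding eq integral_cis[OF False] by auto
  next
    case True
    show ?thesis
    proof (cases "l = 0")
      case False
      then show ?thesis unfolding eq g_def using True integral_legendre[OF False] by simp
    next
      case l: True
      \<comment> \<open>\<open>K\<close> is known only through its defining property; evaluation at
        \<theta> = \<phi> = 0 determines it.\<close>
      have K0: "K = of_real (sqrt (1 / (4 * pi)))"
        using K[of 0 0] True l by (simp add: sph_harm_0_0 legendre_poly_def)
      have "C = c * of_real (1 / (4 * pi))"
        unfolding C_def K0 mult.assoc of_real_mult[symmetric] real_sqrt_mult_self by simp
      moreover have "integral {0..pi} g = 2"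
      proof -
        have "(sin has_integral (- cos pi - - cos 0)) {0..pi}"
          by (rule fundamental_theorem_of_calculus)
            (auto intro!: derivative_eq_intros simp flip: has_real_derivative_iff_has_vector_derivative)
        moreover have "g = sin" using True l by (intro ext) (simp add: g_def legendre_poly_def)
        ultimately show ?thesis by (simp add: integral_unique)
      qed
      ultimately show ?thesis unfolding eq using True l by (simp add: scaleR_conv_of_real)
    qed
  qed
qed

section \<open>Deformation resonances\<close>

lemma hankel1_nonzero:
  assumes "z \<noteq> 0" "poly (bessel_poly l) (- \<i> * z) \<noteq> 0"
  shows "hankel1 l z \<noteq> 0"
  using assms by (simp add: hankel1_bessel)

lemma deformation_resonanceI:
  assumes "poly (bessel_poly l) (- \<i> * (of_real \<epsilon> * lam)) \<noteq> 0"
    and "lam\<^sup>2 + of_real (rhat Ca We \<gamma> l) * Gfun l (of_real \<epsilon> * lam) = 0"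
  shows "deformation_resonance Ca We \<gamma> l \<epsilon> lam"
  unfolding deformation_resonance_def using assms hankel1_nonzero[of "of_real \<epsilon> * lam" l] by blast

text \<open>For l = 0 the polynomial P is 1, so G_0(z) = iz - 1 exactly and the equation is a
  quadratic, solved by completing the square. \<open>csqrt\<close> also covers a negative radicand;
  a zero radicand makes the two listed points coincide.\<close>

lemma deformation_resonances_0:
  fixes Ca We \<gamma> \<epsilon> :: real
  defines "r0 \<equiv> rhat Ca We \<gamma> 0"
  defines "q \<equiv> csqrt (of_real (r0 - r0 ^ 2 / 4 * \<epsilon> ^ 2))" and "h \<equiv> \<i> * complex_of_real (r0 / 2 * \<epsilon>)"
  shows "{lam. deformation_resonance Ca We \<gamma> 0 \<epsilon> lam} = {q - h, - q - h}"
proof -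
  have P: "poly (bessel_poly 0) w = 1" "poly (pderiv (bessel_poly 0)) w = 0" for w
    by (simp_all add: bessel_poly_def bessel_coeff_def pderiv_monom)
  have G: "Gfun 0 z = \<i> * z - 1" for z
    by (subst Gfun_bessel) (simp_all only: P bessel_log_deriv_def, simp_all)
  have hh: "h * h = - of_real (r0\<^sup>2 / 4 * \<epsilon>\<^sup>2)"
    unfolding h_def by (simp add: power2_eq_square algebra_simps)
  have "deformation_resonance Ca We \<gamma> 0 \<epsilon> lam \<longleftrightarrow> lam = q - h \<or> lam = - q - h" for lam
  proof -
    have "deformation_resonance Ca We \<gamma> 0 \<epsilon> lam \<longleftrightarrow> lam\<^sup>2 + of_real r0 * Gfun 0 (of_real \<epsilon> * lam) = 0"
      unfolding deformation_resonance_def r0_def using hankel1_nonzero[of "of_real \<epsilon> * lam" 0]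
      by (auto simp: P)
    also have "lam\<^sup>2 + of_real r0 * Gfun 0 (of_real \<epsilon> * lam) = (lam + h)\<^sup>2 - h * h - of_real r0"
      unfolding G h_def by (simp add: power2_eq_square algebra_simps)
    also have "\<dots> = (lam + h)\<^sup>2 - q\<^sup>2"
      unfolding hh q_def power2_csqrt by simp
    also have "\<dots> = 0 \<longleftrightarrow> lam + h = q \<or> lam + h = - q"
      by (simp add: power2_eq_iff)
    finally show ?thesis by (auto simp: algebra_simps)
  qed
  then show ?thesis by auto
qed

lemma deformation_resonance_pair:
  fixes Ca We \<gamma> :: real and l :: nat
  assumes We: "We > 0" and l: "l \<ge> 2"
  shows "\<exists>\<epsilon>0>0. \<exists>C. \<forall>\<epsilon>. 0 < \<epsilon> \<and> \<epsilon> \<le> \<epsilon>0 \<longrightarrow>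
     (\<exists>lamp lamm. lamp \<noteq> lamm \<and>
        deformation_resonance Ca We \<gamma> l \<epsilon> lamp \<and> deformation_resonance Ca We \<gamma> l \<epsilon> lamm \<and>
        (\<forall>s\<in>{1, -1::real}. \<forall>lam. lam = (if s = 1 then lamp else lamm) \<longrightarrow>
           (\<exists>E F :: real. \<bar>E\<bar> \<le> C * \<epsilon> ^ 4 \<and> \<bar>F\<bar> \<le> C * (\<epsilon> / sqrt We) ^ (2 * l + 4) \<and>
              Re lam = s * sqrt ((1 / We) * (real l + 2) * (real l - 1) * (real l + 1)) *
                 (1 - (real l + 2) * (real l - 1) / (2 * (2 * real l - 1)) * (\<epsilon> / sqrt We) ^ 2 + E) \<and>
              Im lam = - (1 / \<epsilon>) *
                 (1 / 2 * ((real l + 2) * (real l - 1)) ^ (l + 1) * (real l + 1) ^ l *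
                    (2 ^ l * fact l / fact (2 * l)) ^ 2 * (\<epsilon> / sqrt We) ^ (2 * l + 2) + F))))"
proof -
  let ?k = "(2 ^ l * fact l / fact (2 * l))\<^sup>2 :: real"
  define p where "p = (real l + 2) * (real l - 1)"
  define r where "r = rhat Ca We \<gamma> l"
  define a where "a = 1 / (2 * real l - 1)"
  define n where "n = real l + 1"
  have r: "r = (1 / We) * (real l + 2) * (real l - 1)" using l by (simp add: r_def rhat_def)
  have rp: "r = p / We" by (simp add: r p_def)
  have r0: "r > 0" using l We by (simp add: r)
  obtain \<rho> M where *: "\<rho> > 0" "M > 0"
    and nz: "\<And>z. norm z \<le> \<rho> \<Longrightarrow> poly (bessel_poly l) (- \<i> * z) \<noteq> 0"
    and cont: "continuous_on (cball 0 \<rho>) (Gfun l)"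
    and G1: "\<And>z. norm z \<le> \<rho> \<Longrightarrow> norm (Gfun l z + of_nat (l + 1) - z\<^sup>2 / (2 * of_nat l - 1)) \<le> M * norm z ^ 4"
    and G2: "\<And>z. norm z \<le> \<rho> \<Longrightarrow> norm (Gfun l z - Gfun l (Re z)) \<le> M * norm z * \<bar>Im z\<bar>"
    and G3: "\<And>x. \<bar>x\<bar> \<le> \<rho> \<Longrightarrow> \<bar>Im (Gfun l (complex_of_real x)) - ?k * x ^ (2 * l + 1)\<bar> \<le> M * \<bar>x\<bar> ^ (2 * l + 3)"
    using Gfun_expansion[OF l] by blast
  have G1': "norm (Gfun l z + of_real (real l + 1) - of_real (1 / (2 * real l - 1)) * z\<^sup>2) \<le> M * norm z ^ 4"
    if "norm z \<le> \<rho>" for z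
    using G1[OF that] by (simp add: add_ac)
  define \<Lambda> where "\<Lambda> = sqrt (r * n)"
  obtain \<epsilon>0 C where "\<epsilon>0 > 0" and ex: "\<And>\<epsilon>. 0 < \<epsilon> \<and> \<epsilon> \<le> \<epsilon>0 \<Longrightarrow> (\<exists>lam. norm (of_real \<epsilon> * lam) \<le> \<rho> \<and> Re lam > 0 \<and>
      lam\<^sup>2 + of_real r * Gfun l (of_real \<epsilon> * lam) = 0 \<and>
      \<bar>Re lam / \<Lambda> - (1 - r * a * \<epsilon>\<^sup>2 / 2)\<bar> \<le> C * \<epsilon> ^ 4 \<and>
      \<bar>\<epsilon> * Im lam + ?k / 2 * r ^ (l + 1) * n ^ l * \<epsilon> ^ (2 * l + 2)\<bar> \<le> C * \<epsilon> ^ (2 * l + 4))"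
    using resonance_expansion[OF l r0 * cont G1' G2 G3] unfolding \<Lambda>_def a_def n_def by blast
  have \<Lambda>0: "\<Lambda> > 0" unfolding \<Lambda>_def n_def using r0 by (simp add: add_pos_pos)
  \<comment> \<open>One constant for both errors: the second is measured in \<epsilon> / sqrt We,
    which costs the factor We^(l+2).\<close>
  define C' where "C' = \<bar>C\<bar> * (1 + We ^ (l + 2))"
  show ?thesis
  proof (rule exI[of _ \<epsilon>0], intro conjI exI[of _ C'] allI impI \<open>\<epsilon>0 > 0\<close>)
    fix \<epsilon> :: real assume \<epsilon>: "0 < \<epsilon> \<and> \<epsilon> \<le> \<epsilon>0"
    from ex[OF \<epsilon>] obtain lam where lam: "norm (of_real \<epsilon> * lam) \<le> \<rho>" "Re lam > 0"
      "lam\<^sup>2 + of_real r * Gfun l (of_real \<epsilon> * lam) = 0"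
      and E: "\<bar>Re lam / \<Lambda> - (1 - r * a * \<epsilon>\<^sup>2 / 2)\<bar> \<le> C * \<epsilon> ^ 4"
      and F: "\<bar>\<epsilon> * Im lam + ?k / 2 * r ^ (l + 1) * n ^ l * \<epsilon> ^ (2 * l + 2)\<bar> \<le> C * \<epsilon> ^ (2 * l + 4)"
      by blast
    define E where "E = Re lam / \<Lambda> - (1 - r * a * \<epsilon>\<^sup>2 / 2)"
    \<comment> \<open>The sign matches the prefactor -1/\<epsilon>, under which F is added to the
      leading term.\<close>
    define F where "F = - (\<epsilon> * Im lam + ?k / 2 * r ^ (l + 1) * n ^ l * \<epsilon> ^ (2 * l + 2))"
    have pw: "(\<epsilon> / sqrt We) ^ (2 * j) = \<epsilon> ^ (2 * j) / We ^ j" for j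
      using We by (simp add: power_mult power_divide)
    have sq: "(\<epsilon> / sqrt We)\<^sup>2 = \<epsilon>\<^sup>2 / We" using pw[of 1] by simp
    have W: "(\<epsilon> / sqrt We) ^ (2 * l + 4) = \<epsilon> ^ (2 * l + 4) / We ^ (l + 2)"
      "(\<epsilon> / sqrt We) ^ (2 * l + 2) = \<epsilon> ^ (2 * l + 2) / We ^ (l + 1)"
      using pw[of "l + 2"] pw[of "l + 1"] by (simp_all only: add_mult_distrib2 mult_1_right, simp_all)
    have bE: "\<bar>E\<bar> \<le> C' * \<epsilon> ^ 4"
    proof -
      have "C \<le> C'" unfolding C'_def using We by (simp add: algebra_simps) (smt (verit) mult_nonneg_nonneg zero_less_power)
      then show ?thesis using E \<epsilon> unfolding E_def by (smt (verit) mult_right_mono zero_le_power)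
    qed
    have bF: "\<bar>F\<bar> \<le> C' * (\<epsilon> / sqrt We) ^ (2 * l + 4)"
    proof -
      have "\<bar>F\<bar> \<le> C * \<epsilon> ^ (2 * l + 4)" using F unfolding F_def by (simp only: abs_minus_cancel)
      also have "\<dots> = (C * We ^ (l + 2)) * (\<epsilon> / sqrt We) ^ (2 * l + 4)"
        unfolding W using We by simp
      also have "\<dots> \<le> C' * (\<epsilon> / sqrt We) ^ (2 * l + 4)"
      proof (rule mult_right_mono)
        have "C * We ^ (l + 2) \<le> \<bar>C\<bar> * We ^ (l + 2)" using We by (intro mult_right_mono) auto
        also have "\<dots> \<le> C'" unfolding C'_def by (simp add: algebra_simps)
        finally show "C * We ^ (l + 2) \<le> C'" .
      qed (use \<epsilon> We in simp)
      finally show ?thesis .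
    qed
    have "Re lam = \<Lambda> * (1 - r * a * \<epsilon>\<^sup>2 / 2 + E)"
      unfolding E_def using \<Lambda>0 by simp
    moreover have "r * a * \<epsilon>\<^sup>2 / 2 = (real l + 2) * (real l - 1) / (2 * (2 * real l - 1)) * (\<epsilon> / sqrt We)\<^sup>2"
      unfolding sq r a_def by simp
    moreover have "\<Lambda> = sqrt ((1 / We) * (real l + 2) * (real l - 1) * (real l + 1))"
      by (simp only: \<Lambda>_def r n_def)
    ultimately have Re: "Re lam = sqrt ((1 / We) * (real l + 2) * (real l - 1) * (real l + 1)) *
        (1 - (real l + 2) * (real l - 1) / (2 * (2 * real l - 1)) * (\<epsilon> / sqrt We)\<^sup>2 + E)"
      by (simp only:)
    have "- (1 / \<epsilon>) * (?k / 2 * r ^ (l + 1) * n ^ l * \<epsilon> ^ (2 * l + 2) + F) = Im lam"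
      unfolding F_def using \<epsilon> by simp
    moreover have "?k / 2 * r ^ (l + 1) * n ^ l * \<epsilon> ^ (2 * l + 2)
        = 1 / 2 * ((real l + 2) * (real l - 1)) ^ (l + 1) * (real l + 1) ^ l * ?k * (\<epsilon> / sqrt We) ^ (2 * l + 2)"
    proof -
      have "K / 2 * (A / B) * N * X = 1 / 2 * A * N * K * (X / B)" for K A B N X :: real by simp
      then show ?thesis unfolding W rp power_divide[of p We] p_def[symmetric] n_def[symmetric] .
    qed
    ultimately have Im: "Im lam = - (1 / \<epsilon>) * (1 / 2 * ((real l + 2) * (real l - 1)) ^ (l + 1) * (real l + 1) ^ l *
                    ?k * (\<epsilon> / sqrt We) ^ (2 * l + 2) + F)"
      by (simp only:)
    have d1: "deformation_resonance Ca We \<gamma> l \<epsilon> lam"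
      using nz[OF lam(1)] lam(3) unfolding r_def by (rule deformation_resonanceI)
    have d2: "deformation_resonance Ca We \<gamma> l \<epsilon> (- cnj lam)"
    proof (rule deformation_resonanceI)
      have z: "of_real \<epsilon> * (- cnj lam) = - cnj (of_real \<epsilon> * lam)" by simp
      show "poly (bessel_poly l) (- \<i> * (of_real \<epsilon> * (- cnj lam))) \<noteq> 0"
        unfolding z by (rule Gfun_uminus_cnj(2)[OF nz[OF lam(1)]])
      have "(- cnj lam)\<^sup>2 + of_real r * Gfun l (of_real \<epsilon> * (- cnj lam))
          = cnj (lam\<^sup>2 + of_real r * Gfun l (of_real \<epsilon> * lam))"
        unfolding z Gfun_uminus_cnj(1)[OF nz[OF lam(1)]] by simp
      then show "(- cnj lam)\<^sup>2 + of_real (rhat Ca We \<gamma> l) * Gfun l (of_real \<epsilon> * (- cnj lam)) = 0"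
        unfolding lam(3) by (simp add: r_def)
    qed
    have ne: "lam \<noteq> - cnj lam" using lam(2) by (auto simp: complex_eq_iff)
    show "\<exists>lamp lamm. lamp \<noteq> lamm \<and>
        deformation_resonance Ca We \<gamma> l \<epsilon> lamp \<and> deformation_resonance Ca We \<gamma> l \<epsilon> lamm \<and>
        (\<forall>s\<in>{1, -1::real}. \<forall>lam. lam = (if s = 1 then lamp else lamm) \<longrightarrow>
           (\<exists>E F :: real. \<bar>E\<bar> \<le> C' * \<epsilon> ^ 4 \<and> \<bar>F\<bar> \<le> C' * (\<epsilon> / sqrt We) ^ (2 * l + 4) \<and>
              Re lam = s * sqrt ((1 / We) * (real l + 2) * (real l - 1) * (real l + 1)) *
                 (1 - (real l + 2) * (real l - 1) / (2 * (2 * real l - 1)) * (\<epsilon> / sqrt We) ^ 2 + E) \<and>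
              Im lam = - (1 / \<epsilon>) *
                 (1 / 2 * ((real l + 2) * (real l - 1)) ^ (l + 1) * (real l + 1) ^ l *
                    (2 ^ l * fact l / fact (2 * l)) ^ 2 * (\<epsilon> / sqrt We) ^ (2 * l + 2) + F)))"
    proof (rule exI[of _ lam], rule exI[of _ "- cnj lam"], intro conjI ballI allI impI ne d1 d2)
      fix s :: real and lam' assume s: "s \<in> {1, -1}" and lam': "lam' = (if s = 1 then lam else - cnj lam)"
      have eq: "Re lam' = s * Re lam" "Im lam' = Im lam" using s lam' by auto
      show "\<exists>E F :: real. \<bar>E\<bar> \<le> C' * \<epsilon> ^ 4 \<and> \<bar>F\<bar> \<le> C' * (\<epsilon> / sqrt We) ^ (2 * l + 4) \<and>
              Re lam' = s * sqrt ((1 / We) * (real l + 2) * (real l - 1) * (real l + 1)) *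
                 (1 - (real l + 2) * (real l - 1) / (2 * (2 * real l - 1)) * (\<epsilon> / sqrt We) ^ 2 + E) \<and>
              Im lam' = - (1 / \<epsilon>) *
                 (1 / 2 * ((real l + 2) * (real l - 1)) ^ (l + 1) * (real l + 1) ^ l *
                    (2 ^ l * fact l / fact (2 * l)) ^ 2 * (\<epsilon> / sqrt We) ^ (2 * l + 2) + F)"
        by (rule exI[of _ E], rule exI[of _ F], intro conjI bE bF) (simp_all only: eq Re Im mult.assoc)
    qed
  qed
qed

section \<open>Undamped modes of the incompressible equations\<close>

text \<open>The kinematic condition at r = 1 reads -(l+1) A = -i \<sigma> B, which dictates A. The
  dynamic condition then reduces to the hypothesis on \<sigma>^2.\<close>

lemma solves_linearized_mode:
  fixes Ca We \<gamma> \<sigma> :: real and l :: nat and m :: int and B :: complex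
  defines "\<delta> \<equiv> (if l = 0 then 1 else 0 :: real)"
  defines "A \<equiv> \<i> * of_real \<sigma> * B / of_nat (l + 1)"
  assumes m: "- int l \<le> m" "m \<le> int l"
    and \<sigma>: "\<sigma>\<^sup>2 = 3 * \<gamma> * (Ca / 2 + 2 / We) * \<delta> + (1 / We) * (real l + 2) * (real l + 1) * (real l - 1)"
  shows "solves_linearized Ca We \<gamma>
    (\<lambda>t x. A * exp (- \<i> * of_real \<sigma> * of_real t) * sph_harm l m (x /\<^sub>R norm x) * of_real (norm x powr (- real l - 1)))
    (\<lambda>t \<omega>. B * exp (- \<i> * of_real \<sigma> * of_real t) * sph_harm l m \<omega>)"
proof -
  let ?e = "\<lambda>t::real. exp (- \<i> * of_real \<sigma> * of_real t)"
  let ?Y = "sph_harm l m"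
  have de: "((\<lambda>s. D * ?e s * y) has_vector_derivative D * (- \<i> * of_real \<sigma> * ?e t) * y) (at t)" for D y t
  proof -
    have "((\<lambda>z. D * exp (- \<i> * of_real \<sigma> * z) * y) has_field_derivative D * (- \<i> * of_real \<sigma> * ?e t) * y) (at (of_real t))"
      by (rule derivative_eq_intros refl)+ simp
    then show ?thesis by (rule has_vector_derivative_real_field)
  qed
  have A: "A * of_nat (l + 1) = \<i> * of_real \<sigma> * B"
    unfolding A_def using of_nat_neq_0[where 'a=complex, of l] by (simp del: of_nat_Suc)
  have lap: "has_laplacian (\<lambda>x. A * ?e t * ?Y (x /\<^sub>R norm x) * of_real (norm x powr (- real l - 1))) 0 x"
    if "norm x > 1" for t x
  proof -
    have "x \<noteq> 0" using that by auto
    moreover have "(- real l - 1) * (- real l - 1 + 1) - real l * (real l + 1) = 0" by (simp add: algebra_simps)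
    ultimately show ?thesis
      using has_laplacian_cmult[OF sph_harm_has_laplacian[of x l m "- real l - 1"], of "A * ?e t"]
      by (simp add: mult.assoc)
  qed
  have slap: "has_sphere_laplacian (\<lambda>\<omega>. B * ?e t * ?Y \<omega>) (- of_real (real l * (real l + 1)) * (B * ?e t * ?Y \<omega>)) \<omega>"
    if "norm \<omega> = 1" for t \<omega>
  proof -
    have nz: "\<omega> \<noteq> 0" using that by auto
    \<comment> \<open>The case a = 0 is the 0-homogeneous extension in the definition of the sphere
      Laplacian. The two functions are matched away from the origin only, as \<open>0 powr 0\<close>
      is 0.\<close>
    have "has_laplacian (\<lambda>y. B * ?e t * (?Y (y /\<^sub>R norm y) * of_real (norm y powr 0)))
        (- of_real (real l * (real l + 1)) * (B * ?e t * ?Y \<omega>)) \<omega>"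
      using has_laplacian_cmult[OF sph_harm_has_laplacian[OF nz, of l m 0], of "B * ?e t"] that
      by (simp add: mult_ac)
    then show ?thesis
      unfolding has_sphere_laplacian_def
      by (rule has_laplacian_cong[of _ _ _ "- {0}"]) (use nz in auto)
  qed
  have rad: "((\<lambda>r. A * ?e t * ?Y ((r *\<^sub>R \<omega>) /\<^sub>R norm (r *\<^sub>R \<omega>)) * of_real (norm (r *\<^sub>R \<omega>) powr (- real l - 1)))
      has_vector_derivative B * (- \<i> * of_real \<sigma> * ?e t) * ?Y \<omega>) (at 1 within {1..})"
    if "norm \<omega> = 1" for t \<omega>
  proof -
    \<comment> \<open>Along the ray the direction stays \<omega>, so only the radial power is
      differentiated.\<close>
    have "((\<lambda>r. r powr (- real l - 1)) has_real_derivative (- real l - 1)) (at 1)"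
      by (auto intro!: derivative_eq_intros)
    then have "((\<lambda>r. A * ?e t * ?Y \<omega> * of_real (r powr (- real l - 1))) has_vector_derivative
        A * ?e t * ?Y \<omega> * of_real (- real l - 1)) (at 1 within {1..})"
      by (intro has_vector_derivative_mult_right has_vector_derivative_of_real)
        (rule has_field_derivative_at_within)
    also have "A * ?e t * ?Y \<omega> * of_real (- real l - 1) = - (A * of_nat (l + 1)) * ?e t * ?Y \<omega>"
      by (simp add: algebra_simps)
    also have "\<dots> = B * (- \<i> * of_real \<sigma> * ?e t) * ?Y \<omega>"
      unfolding A by (simp add: algebra_simps)
    finally show ?thesis
      by (rule has_vector_derivative_transform[rotated 2]) (use that in auto)
  qed
  have inner: "sphere_inner (\<lambda>\<omega>. B * ?e t * ?Y \<omega>) (sph_harm 0 0) * sph_harm 0 0 \<omega> = of_real \<delta> * (B * ?e t * ?Y \<omega>)" for t \<omega>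
    unfolding sphere_inner_sph_harm_0[OF m] \<delta>_def using m by auto
  have dyn: "((\<lambda>s. A * ?e s * ?Y (\<omega> /\<^sub>R norm \<omega>) * of_real (norm \<omega> powr (- real l - 1))) has_vector_derivative
      of_real (3 * \<gamma> * (Ca / 2 + 2 / We)) * sphere_inner (\<lambda>\<omega>. B * ?e t * ?Y \<omega>) (sph_harm 0 0) * sph_harm 0 0 \<omega>
      - of_real (1 / We) * (2 * (B * ?e t * ?Y \<omega>) + - of_real (real l * (real l + 1)) * (B * ?e t * ?Y \<omega>))) (at t)"
    if "norm \<omega> = 1" for t \<omega>
  proof -
    let ?c = "3 * \<gamma> * (Ca / 2 + 2 / We)"
    \<comment> \<open>2 - l(l+1) = -(l+2)(l-1), and \<delta> (l+1) = \<delta> because \<delta> is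
      nonzero only at l = 0. The common factor l + 1 is what the denominator of A cancels.\<close>
    have \<sigma>2: "\<sigma>\<^sup>2 = (?c * \<delta> - (1 / We) * (2 - real l * (real l + 1))) * (real l + 1)"
    proof -
      have "(?c * \<delta> - w * (2 - x * (x + 1))) * (x + 1) = ?c * (\<delta> * (x + 1)) + w * (x + 2) * (x + 1) * (x - 1)"
        for w x :: real by (simp add: algebra_simps)
      moreover have "\<delta> * (real l + 1) = \<delta>" by (simp add: \<delta>_def)
      ultimately show ?thesis unfolding \<sigma> by (simp only:)
    qed
    have "complex_of_real (\<sigma>\<^sup>2) = of_real (?c * \<delta> - (1 / We) * (2 - real l * (real l + 1))) * of_nat (l + 1)"
    proof -
      have "complex_of_nat (l + 1) = of_real (real l + 1)" by simp
      then show ?thesis using \<sigma>2 by (simp only: of_real_mult)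
    qed
    moreover have "A * (- \<i> * of_real \<sigma>) * of_nat (l + 1) = (A * of_nat (l + 1)) * (- \<i> * of_real \<sigma>)"
      by (simp only: mult_ac)
    moreover have "\<i> * of_real \<sigma> * B * (- \<i> * of_real \<sigma>) = of_real (\<sigma>\<^sup>2) * B"
    proof -
      have "\<i> * a * b * (- \<i> * a) = - (\<i> * \<i>) * (a * a * b)" for a b :: complex by algebra
      then show ?thesis by (simp add: power2_eq_square)
    qed
    ultimately have "A * (- \<i> * of_real \<sigma>) * of_nat (l + 1)
        = of_real (?c * \<delta> - (1 / We) * (2 - real l * (real l + 1))) * B * of_nat (l + 1)"
      unfolding A by (simp only: mult_ac)
    then have "A * (- \<i> * of_real \<sigma>) = of_real (?c * \<delta> - (1 / We) * (2 - real l * (real l + 1))) * B"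
      by (subst (asm) mult_right_cancel) (simp_all del: of_nat_add of_nat_Suc)
    then have "A * (- \<i> * of_real \<sigma> * ?e t) * ?Y \<omega>
        = of_real (?c * \<delta> - (1 / We) * (2 - real l * (real l + 1))) * (B * ?e t * ?Y \<omega>)"
      by (simp only: mult.assoc[symmetric])
    also have "\<dots> = of_real ?c * sphere_inner (\<lambda>\<omega>. B * ?e t * ?Y \<omega>) (sph_harm 0 0) * sph_harm 0 0 \<omega>
      - of_real (1 / We) * (2 * (B * ?e t * ?Y \<omega>) + - of_real (real l * (real l + 1)) * (B * ?e t * ?Y \<omega>))"
      unfolding mult.assoc[of "of_real ?c"] inner by (simp add: algebra_simps)
    finally show ?thesis
      using de[of A "?Y \<omega>" t] that by simp
  qed
  show ?thesis
    unfolding solves_linearized_def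
  proof (intro conjI allI impI)
    fix t :: real and \<omega> :: "real^3" assume \<omega>: "norm \<omega> = 1"
    show "\<exists>d. ((\<lambda>s. B * ?e s * ?Y \<omega>) has_vector_derivative d) (at t) \<and>
        ((\<lambda>r. A * ?e t * ?Y ((r *\<^sub>R \<omega>) /\<^sub>R norm (r *\<^sub>R \<omega>)) * of_real (norm (r *\<^sub>R \<omega>) powr (- real l - 1)))
          has_vector_derivative d) (at 1 within {1..})"
      using de rad[OF \<omega>] by (intro exI conjI)
    show "\<exists>L. has_sphere_laplacian (\<lambda>\<omega>. B * ?e t * ?Y \<omega>) L \<omega> \<and>
        ((\<lambda>s. A * ?e s * ?Y (\<omega> /\<^sub>R norm \<omega>) * of_real (norm \<omega> powr (- real l - 1))) has_vector_derivative
          of_real (3 * \<gamma> * (Ca / 2 + 2 / We)) * sphere_inner (\<lambda>\<omega>. B * ?e t * ?Y \<omega>) (sph_harm 0 0) * sph_harm 0 0 \<omega>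
          - of_real (1 / We) * (2 * (B * ?e t * ?Y \<omega>) + L)) (at t)"
      using slap[OF \<omega>] dyn[OF \<omega>] by (intro exI conjI)
  qed (use lap in blast)
qed

theorem theorem6p2:
  fixes Ca We \<gamma> :: real
  assumes hCa: "Ca > 0" and hWe: "We > 0" and h\<gamma>: "\<gamma> > 1"
  shows
    \<comment> \<open>(i) l = 0\<close>
    "(\<forall>\<epsilon>>0. let r0 = 3 * \<gamma> / 2 * Ca + 2 * (3 * \<gamma> - 1) * (1 / We) in
        {lam. deformation_resonance Ca We \<gamma> 0 \<epsilon> lam} =
        { csqrt (complex_of_real (r0 - r0 ^ 2 / 4 * \<epsilon> ^ 2)) - \<i> * complex_of_real (r0 / 2 * \<epsilon>),
          - csqrt (complex_of_real (r0 - r0 ^ 2 / 4 * \<epsilon> ^ 2)) - \<i> * complex_of_real (r0 / 2 * \<epsilon>) })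
   \<and>
    \<comment> \<open>(ii) 2 \<le> l \<le> L*\<close>
    (\<forall>Lstar::nat. Lstar > 2 \<longrightarrow>
       (\<exists>\<epsilon>star > 0. \<exists>C :: nat \<Rightarrow> real.
          \<forall>\<epsilon>. 0 < \<epsilon> \<and> \<epsilon> \<le> \<epsilon>star \<longrightarrow>
            (\<forall>l::nat. 2 \<le> l \<and> l \<le> Lstar \<longrightarrow>
               (\<exists>lamp lamm. lamp \<noteq> lamm \<and>
                  deformation_resonance Ca We \<gamma> l \<epsilon> lamp \<and>
                  deformation_resonance Ca We \<gamma> l \<epsilon> lamm \<and>
                  (\<forall>s\<in>{1, -1::real}. \<forall>lam. lam = (if s = 1 then lamp else lamm) \<longrightarrow>
                     (\<exists>E F :: real. \<bar>E\<bar> \<le> C l * \<epsilon> ^ 4 \<and>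
                        \<bar>F\<bar> \<le> C l * (\<epsilon> / sqrt We) ^ (2 * l + 4) \<and>
                        Re lam = s * sqrt ((1 / We) * (real l + 2) * (real l - 1) * (real l + 1)) *
                           (1 - (real l + 2) * (real l - 1) / (2 * (2 * real l - 1)) * (\<epsilon> / sqrt We) ^ 2 + E) \<and>
                        Im lam = - (1 / \<epsilon>) *
                           (1 / 2 * ((real l + 2) * (real l - 1)) ^ (l + 1) * (real l + 1) ^ l *
                              (2 ^ l * fact l / fact (2 * l)) ^ 2 * (\<epsilon> / sqrt We) ^ (2 * l + 2) + F)))))))
   \<and>
    \<comment> \<open>(iii) the limit eps \<rightarrow> 0+\<close>
    (\<forall>l::nat. l \<noteq> 1 \<longrightarrow>
       (let c = 3 * \<gamma> * (Ca / 2 + 2 / We);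
            \<delta> = (if l = 0 then 1 else 0 :: real);
            v = c * \<delta> + (1 / We) * (real l + 2) * (real l + 1) * (real l - 1) in
        (\<forall>lam. ((\<lambda>\<epsilon>. lam ^ 2 + complex_of_real (rhat Ca We \<gamma> l) * Gfun l (complex_of_real \<epsilon> * lam))
                 \<longlongrightarrow> lam ^ 2 + complex_of_real (rhat Ca We \<gamma> l) * Gfun l 0) (at_right 0)) \<and>
        (\<forall>lam. lam ^ 2 + complex_of_real (rhat Ca We \<gamma> l) * Gfun l 0 =
               lam ^ 2 - complex_of_real (c * \<delta>)
               - complex_of_real ((1 / We) * (real l + 2) * (real l + 1) * (real l - 1))) \<and>
        v > 0 \<and>
        {lam. lam ^ 2 + complex_of_real (rhat Ca We \<gamma> l) * Gfun l 0 = 0} =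
          {complex_of_real (sqrt v), complex_of_real (- sqrt v)} \<and>
        (\<forall>m::int. - int l \<le> m \<and> m \<le> int l \<longrightarrow>
           (\<forall>s\<in>{1, -1::real}. \<forall>B::complex. \<exists>A::complex.
              solves_linearized Ca We \<gamma>
                (\<lambda>t x. A * exp (- \<i> * complex_of_real (s * sqrt v) * complex_of_real t)
                        * sph_harm l m (x /\<^sub>R norm x) * complex_of_real (norm x powr (- real l - 1)))
                (\<lambda>t \<omega>. B * exp (- \<i> * complex_of_real (s * sqrt v) * complex_of_real t)
                        * sph_harm l m \<omega>)))))"
proof (intro conjI allI impI)
  fix \<epsilon> :: real assume "\<epsilon> > 0"
  show "let r0 = 3 * \<gamma> / 2 * Ca + 2 * (3 * \<gamma> - 1) * (1 / We) in
        {lam. deformation_resonance Ca We \<gamma> 0 \<epsilon> lam} =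
        { csqrt (complex_of_real (r0 - r0 ^ 2 / 4 * \<epsilon> ^ 2)) - \<i> * complex_of_real (r0 / 2 * \<epsilon>),
          - csqrt (complex_of_real (r0 - r0 ^ 2 / 4 * \<epsilon> ^ 2)) - \<i> * complex_of_real (r0 / 2 * \<epsilon>) }"
  proof -
    have "rhat Ca We \<gamma> 0 = 3 * \<gamma> / 2 * Ca + 2 * (3 * \<gamma> - 1) * (1 / We)"
      by (simp only: rhat_def refl if_True)
    then show ?thesis
      using deformation_resonances_0[of Ca We \<gamma> \<epsilon>] by (simp only: Let_def)
  qed
next
  fix Lstar :: nat assume L: "Lstar > 2"
  obtain e C where e: "\<And>l. l \<ge> 2 \<Longrightarrow> e l > 0" and ex: "\<And>l \<epsilon>. l \<ge> 2 \<Longrightarrow> 0 < \<epsilon> \<and> \<epsilon> \<le> e l \<Longrightarrow>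
     (\<exists>lamp lamm. lamp \<noteq> lamm \<and>
        deformation_resonance Ca We \<gamma> l \<epsilon> lamp \<and> deformation_resonance Ca We \<gamma> l \<epsilon> lamm \<and>
        (\<forall>s\<in>{1, -1::real}. \<forall>lam. lam = (if s = 1 then lamp else lamm) \<longrightarrow>
           (\<exists>E F :: real. \<bar>E\<bar> \<le> C l * \<epsilon> ^ 4 \<and> \<bar>F\<bar> \<le> C l * (\<epsilon> / sqrt We) ^ (2 * l + 4) \<and>
              Re lam = s * sqrt ((1 / We) * (real l + 2) * (real l - 1) * (real l + 1)) *
                 (1 - (real l + 2) * (real l - 1) / (2 * (2 * real l - 1)) * (\<epsilon> / sqrt We) ^ 2 + E) \<and>
              Im lam = - (1 / \<epsilon>) *
                 (1 / 2 * ((real l + 2) * (real l - 1)) ^ (l + 1) * (real l + 1) ^ l *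
                    (2 ^ l * fact l / fact (2 * l)) ^ 2 * (\<epsilon> / sqrt We) ^ (2 * l + 2) + F))))"
    using deformation_resonance_pair[OF hWe, of _ Ca \<gamma>] by metis
  \<comment> \<open>Only finitely many l occur, so the least threshold serves them all; the
    constants \<open>C l\<close> are fixed per l, independently of \<open>Lstar\<close>.\<close>
  let ?s = "Min (e ` {2..Lstar})"
  have "?s > 0" using L e by (subst Min_gr_iff) auto
  moreover have "?s \<le> e l" if "2 \<le> l \<and> l \<le> Lstar" for l
    using that by (intro Min_le) auto
  ultimately show "\<exists>\<epsilon>star > 0. \<exists>C :: nat \<Rightarrow> real.
          \<forall>\<epsilon>. 0 < \<epsilon> \<and> \<epsilon> \<le> \<epsilon>star \<longrightarrow>
            (\<forall>l::nat. 2 \<le> l \<and> l \<le> Lstar \<longrightarrow>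
               (\<exists>lamp lamm. lamp \<noteq> lamm \<and>
                  deformation_resonance Ca We \<gamma> l \<epsilon> lamp \<and>
                  deformation_resonance Ca We \<gamma> l \<epsilon> lamm \<and>
                  (\<forall>s\<in>{1, -1::real}. \<forall>lam. lam = (if s = 1 then lamp else lamm) \<longrightarrow>
                     (\<exists>E F :: real. \<bar>E\<bar> \<le> C l * \<epsilon> ^ 4 \<and>
                        \<bar>F\<bar> \<le> C l * (\<epsilon> / sqrt We) ^ (2 * l + 4) \<and>
                        Re lam = s * sqrt ((1 / We) * (real l + 2) * (real l - 1) * (real l + 1)) *
                           (1 - (real l + 2) * (real l - 1) / (2 * (2 * real l - 1)) * (\<epsilon> / sqrt We) ^ 2 + E) \<and>
                        Im lam = - (1 / \<epsilon>) *
                           (1 / 2 * ((real l + 2) * (real l - 1)) ^ (l + 1) * (real l + 1) ^ l *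
                              (2 ^ l * fact l / fact (2 * l)) ^ 2 * (\<epsilon> / sqrt We) ^ (2 * l + 2) + F)))))"
    by (intro exI[of _ ?s] exI[of _ C] conjI allI impI ex) (auto intro: order_trans)
next
  fix l :: nat assume l1: "l \<noteq> 1"
  define c where "c = 3 * \<gamma> * (Ca / 2 + 2 / We)"
  define \<delta> where "\<delta> = (if l = 0 then 1 else 0 :: real)"
  define v where "v = c * \<delta> + (1 / We) * (real l + 2) * (real l + 1) * (real l - 1)"
  have G0: "Gfun l 0 = - of_nat (l + 1)" by (simp add: Gfun_def)
  have lim: "((\<lambda>\<epsilon>. lam ^ 2 + complex_of_real (rhat Ca We \<gamma> l) * Gfun l (complex_of_real \<epsilon> * lam))
                 \<longlongrightarrow> lam ^ 2 + complex_of_real (rhat Ca We \<gamma> l) * Gfun l 0) (at_right 0)" for lam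
  proof -
    have "filterlim (\<lambda>\<epsilon>. complex_of_real \<epsilon> * lam) (nhds 0) (at_right 0)"
      by (auto intro!: tendsto_eq_intros)
    from filterlim_compose[OF Gfun_tendsto_0 this] show ?thesis
      by (intro tendsto_intros)
  qed
  \<comment> \<open>At l = 0 the product (l+2)(l+1)(l-1) is -2, which accounts for the difference
    between \<open>rhat\<close> and \<open>c\<close>.\<close>
  have red: "rhat Ca We \<gamma> l * (real l + 1) = v"
    unfolding rhat_def v_def c_def \<delta>_def using hWe by (auto simp: field_simps)
  have red': "complex_of_real (rhat Ca We \<gamma> l) * Gfun l 0 = - of_real v"
    unfolding red[symmetric] G0 by (simp add: algebra_simps)
  \<comment> \<open>At l = 0 the negative term -2/We is outweighed by the summand 6 \<gamma> / We of
    \<open>c\<close>, as \<gamma> > 1.\<close>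
  have v0: "v > 0"
  proof (cases "l = 0")
    case True
    have "c - 2 / We = 3 * \<gamma> * Ca / 2 + (6 * \<gamma> - 2) / We"
      unfolding c_def using hWe by (simp add: field_simps)
    also have "\<dots> > 0" using assms by (intro add_pos_pos) auto
    finally show ?thesis using True by (simp add: v_def \<delta>_def)
  next
    case False
    then have "real l > 1" using l1 by simp
    then show ?thesis using False hWe by (simp add: v_def \<delta>_def)
  qed
  have roots: "{lam. lam ^ 2 + complex_of_real (rhat Ca We \<gamma> l) * Gfun l 0 = 0} =
          {complex_of_real (sqrt v), complex_of_real (- sqrt v)}"
  proof -
    have "lam\<^sup>2 + - of_real v = 0 \<longleftrightarrow> lam = of_real (sqrt v) \<or> lam = - of_real (sqrt v)" for lam :: complex
    proof -
      have "complex_of_real v = (of_real (sqrt v))\<^sup>2" using v0 by (simp flip: of_real_power)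
      then show ?thesis by (simp add: power2_eq_iff)
    qed
    then show ?thesis unfolding red' by auto
  qed
  have sol: "\<exists>A::complex. solves_linearized Ca We \<gamma>
                (\<lambda>t x. A * exp (- \<i> * complex_of_real (s * sqrt v) * complex_of_real t)
                        * sph_harm l m (x /\<^sub>R norm x) * complex_of_real (norm x powr (- real l - 1)))
                (\<lambda>t \<omega>. B * exp (- \<i> * complex_of_real (s * sqrt v) * complex_of_real t)
                        * sph_harm l m \<omega>)" if "- int l \<le> m \<and> m \<le> int l" "s \<in> {1, -1::real}" for m s B
  proof -
    have "(s * sqrt v)\<^sup>2 = v" using that(2) v0 by auto
    then have "(s * sqrt v)\<^sup>2 = 3 * \<gamma> * (Ca / 2 + 2 / We) * (if l = 0 then 1 else 0)
        + (1 / We) * (real l + 2) * (real l + 1) * (real l - 1)"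
      unfolding v_def c_def \<delta>_def .
    then show ?thesis
      using solves_linearized_mode[of l m "s * sqrt v" \<gamma> Ca We B] that(1) by blast
  qed
  show "let c = 3 * \<gamma> * (Ca / 2 + 2 / We);
            \<delta> = (if l = 0 then 1 else 0 :: real);
            v = c * \<delta> + (1 / We) * (real l + 2) * (real l + 1) * (real l - 1) in
        (\<forall>lam. ((\<lambda>\<epsilon>. lam ^ 2 + complex_of_real (rhat Ca We \<gamma> l) * Gfun l (complex_of_real \<epsilon> * lam))
                 \<longlongrightarrow> lam ^ 2 + complex_of_real (rhat Ca We \<gamma> l) * Gfun l 0) (at_right 0)) \<and>
        (\<forall>lam. lam ^ 2 + complex_of_real (rhat Ca We \<gamma> l) * Gfun l 0 =
               lam ^ 2 - complex_of_real (c * \<delta>)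
               - complex_of_real ((1 / We) * (real l + 2) * (real l + 1) * (real l - 1))) \<and>
        v > 0 \<and>
        {lam. lam ^ 2 + complex_of_real (rhat Ca We \<gamma> l) * Gfun l 0 = 0} =
          {complex_of_real (sqrt v), complex_of_real (- sqrt v)} \<and>
        (\<forall>m::int. - int l \<le> m \<and> m \<le> int l \<longrightarrow>
           (\<forall>s\<in>{1, -1::real}. \<forall>B::complex. \<exists>A::complex.
              solves_linearized Ca We \<gamma>
                (\<lambda>t x. A * exp (- \<i> * complex_of_real (s * sqrt v) * complex_of_real t)
                        * sph_harm l m (x /\<^sub>R norm x) * complex_of_real (norm x powr (- real l - 1)))
                (\<lambda>t \<omega>. B * exp (- \<i> * complex_of_real (s * sqrt v) * complex_of_real t)
                        * sph_harm l m \<omega>)))"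
    unfolding Let_def c_def[symmetric] \<delta>_def[symmetric] v_def[symmetric]
  proof (intro conjI allI impI ballI lim v0 roots sol)
    show "lam ^ 2 + complex_of_real (rhat Ca We \<gamma> l) * Gfun l 0 =
               lam ^ 2 - complex_of_real (c * \<delta>)
               - complex_of_real ((1 / We) * (real l + 2) * (real l + 1) * (real l - 1))" for lam
      unfolding red' v_def by simp
  qed auto
qed

end
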